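(* Let $R$ be a J-stable ring. Then $R$ is a Bézout ring if and only if $R$ is an elementary divisor ring.
   Context: All rings are commutative with identity (zero divisors are allowed). $J(R)$ denotes the Jacobson radical of $R$. A ring $R$ has stable range $1$ if whenever $aR+bR=R$ with $a,b\in R$, there is $y\in R$ such that $a+by$ is invertible. A ring $R$ is J-stable if $R/aR$ has stable range $1$ for all $a\in R$ with $a\notin J(R)$. A ring is a Bézout ring if every finitely generated ideal is principal. A (not necessarily square) matrix $A$ over $R$ admits a diagonal reduction if there exist invertible matrices $P,Q$ over $R$ such that $PAQ=(d_{ij})$ is a diagonal matrix (i.e. $d_{ij}=0$ for $i\ne j$) in which $d_{ii}$ is a divisor of $d_{(i+1)(i+1)}$ for each $i$. A ring $R$ is an elementary divisor ring if every matrix over $R$ admits a diagonal reduction. *)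

theory Defs
  imports
    "HOL-Algebra.QuotRing"
    "HOL-Algebra.Divisibility"
    "Jordan_Normal_Form.Matrix"
begin

text \<open>
  A ring is a HOL-Algebra structure \<open>R\<close> with \<open>cring R\<close>. The zero ring is allowed, both for \<open>R\<close>
  itself and for its quotients; the latter occur because \<open>R/aR\<close> is zero when \<open>a\<close> is a unit.
\<close>

definition stable_range_1 :: "('a, 'b) ring_scheme \<Rightarrow> bool" where
  "stable_range_1 R \<longleftrightarrow>
    (\<forall>a \<in> carrier R. \<forall>b \<in> carrier R.
      PIdl\<^bsub>R\<^esub> a <+>\<^bsub>R\<^esub> PIdl\<^bsub>R\<^esub> b = carrier R \<longrightarrow>
      (\<exists>y \<in> carrier R. a \<oplus>\<^bsub>R\<^esub> b \<otimes>\<^bsub>R\<^esub> y \<in> Units R))"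

text \<open>
  The condition \<open>x \<in> carrier R\<close> makes the radical of the zero ring, which has no maximal ideals,
  the whole ring.
\<close>

definition jacobson_radical :: "('a, 'b) ring_scheme \<Rightarrow> 'a set" where
  "jacobson_radical R = {x \<in> carrier R. \<forall>M. maximalideal M R \<longrightarrow> x \<in> M}"

definition J_stable :: "('a, 'b) ring_scheme \<Rightarrow> bool" where
  "J_stable R \<longleftrightarrow>
    (\<forall>a \<in> carrier R. a \<notin> jacobson_radical R \<longrightarrow> stable_range_1 (R Quot (PIdl\<^bsub>R\<^esub> a)))"

definition bezout_ring :: "('a, 'b) ring_scheme \<Rightarrow> bool" where
  "bezout_ring R \<longleftrightarrow>
    (\<forall>S. finite S \<longrightarrow> S \<subseteq> carrier R \<longrightarrow> principalideal (Idl\<^bsub>R\<^esub> S) R)"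

text \<open>
  The type \<open>'a mat\<close> serves only as a container for entries, since its library operations use the
  type class operations on \<open>'a\<close>. The operations below use those of the structure \<open>R\<close>.
\<close>

definition mats :: "('a, 'b) ring_scheme \<Rightarrow> nat \<Rightarrow> nat \<Rightarrow> 'a mat set" where
  "mats R m n = {A \<in> carrier_mat m n. elements_mat A \<subseteq> carrier R}"

definition mat_times :: "('a, 'b) ring_scheme \<Rightarrow> 'a mat \<Rightarrow> 'a mat \<Rightarrow> 'a mat" where
  "mat_times R A B =
    mat (dim_row A) (dim_col B)
      (\<lambda>(i, j). \<Oplus>\<^bsub>R\<^esub>k \<in> {..<dim_col A}. A $$ (i, k) \<otimes>\<^bsub>R\<^esub> B $$ (k, j))"

definition mat_one :: "('a, 'b) ring_scheme \<Rightarrow> nat \<Rightarrow> 'a mat" where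
  "mat_one R n = mat n n (\<lambda>(i, j). if i = j then \<one>\<^bsub>R\<^esub> else \<zero>\<^bsub>R\<^esub>)"

definition invertible_mats :: "('a, 'b) ring_scheme \<Rightarrow> nat \<Rightarrow> 'a mat set" where
  "invertible_mats R n =
    {P \<in> mats R n n. \<exists>P' \<in> mats R n n.
      mat_times R P P' = mat_one R n \<and> mat_times R P' P = mat_one R n}"

definition admits_diagonal_reduction :: "('a, 'b) ring_scheme \<Rightarrow> 'a mat \<Rightarrow> bool" where
  "admits_diagonal_reduction R A \<longleftrightarrow>
    (\<exists>P \<in> invertible_mats R (dim_row A). \<exists>Q \<in> invertible_mats R (dim_col A).
      let D = mat_times R (mat_times R P A) Q in
        (\<forall>i < dim_row A. \<forall>j < dim_col A. i \<noteq> j \<longrightarrow> D $$ (i, j) = \<zero>\<^bsub>R\<^esub>) \<and>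
        (\<forall>i. Suc i < min (dim_row A) (dim_col A) \<longrightarrow>
          D $$ (i, i) divides\<^bsub>R\<^esub> D $$ (Suc i, Suc i)))"

definition elementary_divisor_ring :: "('a, 'b) ring_scheme \<Rightarrow> bool" where
  "elementary_divisor_ring R \<longleftrightarrow>
    (\<forall>m n. \<forall>A \<in> mats R m n. admits_diagonal_reduction R A)"

end

theory Submission
  imports Defs
begin

text \<open>
  That every elementary divisor ring is Bezout is seen by diagonalizing the row \<open>(a, b)\<close>: the
  resulting corner entry is a linear combination of \<open>a\<close> and \<open>b\<close> that divides both, and an induction
  over a finite generating set does the rest.

  For the converse, let \<open>R\<close> be Bezout and J-stable with Jacobson radical \<open>J\<close>. If \<open>a, b, c\<close> generate
  the unit ideal, then either one of two chosen elements, say \<open>a\<close>, lies outside \<open>J\<close> and stable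
  range 1 of \<open>R/aR\<close> can be used, or both lie in \<open>J\<close> and the third element is a unit. This
  dichotomy is used twice.

  First, it shows that \<open>R\<close> has stable range 2 (\<open>stable_range_2\<close>). Consequently \<open>R\<close> is a Hermite
  ring (\<open>hermite\<close>): any pair has the form \<open>(a, b) = d (a', b')\<close> with \<open>a', b'\<close> generating the unit
  ideal. In the presence of zero divisors this is more than the Bezout property. If
  \<open>d = a x + b y\<close>, \<open>a = d a'\<close> and \<open>b = d b'\<close>, then \<open>d\<close> annihilates \<open>c = 1 - a' x - b' y\<close>, so
  \<open>a'\<close> and \<open>b'\<close> may be changed by multiples of \<open>c\<close>, and stable range 2 makes them comaximal.

  Second, it shows that a triangular 2 by 2 matrix whose entries \<open>a, b, c\<close> generate the unit
  ideal represents 1 as (row) * (matrix) * (column)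
  (\<open>unimodular_triangular_represents_one\<close>). After triangularizing and dividing by the content,
  every 2 by 2 matrix represents a common divisor of its entries by unimodular vectors, and these
  can be completed to invertible matrices (\<open>gcd_pivot_2_2\<close>).

  The passage to all sizes is Kaplansky's. Say that size \<open>m\<close> by \<open>n\<close> has gcd pivots if each such
  matrix is equivalent to one whose corner entry divides all entries. Working on all rows but the
  first, and then on the first two rows, raises the number of rows by one (\<open>gcd_pivot_stack\<close>);
  with transposition, the sizes 2 by 1 and 2 by 2 give all the others. A corner entry that divides
  everything clears its row and column, and the remaining block is treated by induction
  (\<open>diagonal_reduction_of_gcd_pivot\<close>).
\<close>

section \<open>Ring arithmetic and maximal ideals\<close>

context cring
begin

text \<open>
  Sorting a sum with associativity and commutativity can leave another summand between an element
  and its negative; these rules let the simplifier cancel such pairs.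
\<close>

lemma separated_cancel:
  assumes "a \<in> carrier R" "b \<in> carrier R" "c \<in> carrier R"
  shows "a \<oplus> (b \<oplus> \<ominus> a) = b" "a \<oplus> (b \<oplus> (\<ominus> a \<oplus> c)) = b \<oplus> c"
    "\<ominus> a \<oplus> (b \<oplus> a) = b" "\<ominus> a \<oplus> (b \<oplus> (a \<oplus> c)) = b \<oplus> c"
  using assms by (metis a_closed a_inv_closed a_lcomm r_neg r_zero a_comm r_neg1 r_neg2)+

lemmas cring_normalize = a_minus_def minus_add l_minus r_minus l_distr r_distr m_ac a_ac
  r_neg l_neg r_neg1 r_neg2 separated_cancel

text \<open>
  Krull's theorem by Zorn's lemma: ideals avoiding \<open>\<one>\<close> are closed under unions of
  nonempty chains.
\<close>

lemma exists_maximalideal: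
  assumes "ideal I R" "\<one> \<notin> I"
  shows "\<exists>M. maximalideal M R \<and> I \<subseteq> M"
proof -
  define A where "A = {J. ideal J R \<and> I \<subseteq> J \<and> \<one> \<notin> J}"
  have "\<exists>M\<in>A. \<forall>X\<in>A. M \<subseteq> X \<longrightarrow> X = M"
  proof (rule subset_Zorn_nonempty)
    show "A \<noteq> {}" using assms by (auto simp: A_def)
    fix C assume ne: "C \<noteq> {}" and ch: "subset.chain A C"
    have id: "ideal J R" if "J \<in> C" for J using ch that by (auto simp: A_def subset.chain_def)
    have tot: "J \<subseteq> K \<or> K \<subseteq> J" if "J \<in> C" "K \<in> C" for J K using ch that by (auto simp: subset.chain_def)
    have "ideal (\<Union>C) R"
    proof (rule idealI[OF ring_axioms])
      show "subgroup (\<Union>C) (add_monoid R)"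
      proof
        show "\<Union>C \<subseteq> carrier (add_monoid R)" using ideal.Icarr[OF id] by auto
        show "\<one>\<^bsub>add_monoid R\<^esub> \<in> \<Union>C" using ne id additive_subgroup.zero_closed[OF ideal.axioms(1)] by fastforce
        show "x \<otimes>\<^bsub>add_monoid R\<^esub> y \<in> \<Union>C" if xy: "x \<in> \<Union>C" "y \<in> \<Union>C" for x y
        proof -
          obtain J K where JK: "J \<in> C" "K \<in> C" "x \<in> J" "y \<in> K" using xy by auto
          then obtain L where L: "L \<in> C" "x \<in> L" "y \<in> L" using tot[of J K] by auto
          then have "x \<oplus> y \<in> L" using additive_subgroup.a_closed[OF ideal.axioms(1)[OF id]] by blast
          then show ?thesis using L by auto
        qed
        show "inv\<^bsub>add_monoid R\<^esub> x \<in> \<Union>C" if x: "x \<in> \<Union>C" for x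
        proof -
          obtain L where L: "L \<in> C" "x \<in> L" using x by auto
          then have "\<ominus> x \<in> L" using additive_subgroup.a_inv_closed[OF ideal.axioms(1)[OF id]] by blast
          then show ?thesis using L by (auto simp: a_inv_def)
        qed
      qed
      show "x \<otimes> a \<in> \<Union>C" "a \<otimes> x \<in> \<Union>C" if "a \<in> \<Union>C" "x \<in> carrier R" for a x
        using that ideal.I_l_closed[OF id] ideal.I_r_closed[OF id] by blast+
    qed
    moreover have "I \<subseteq> \<Union>C" "\<one> \<notin> \<Union>C" using ch ne unfolding A_def subset.chain_def by blast+
    ultimately show "\<Union>C \<in> A" by (simp add: A_def)
  qed
  then obtain M where M: "M \<in> A" and max: "\<And>X. X \<in> A \<Longrightarrow> M \<subseteq> X \<Longrightarrow> X = M" by blast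
  have "maximalideal M R"
  proof (rule maximalidealI)
    show "ideal M R" using M by (simp add: A_def)
    show "carrier R \<noteq> M" using M by (auto simp: A_def)
    show "J = M \<or> J = carrier R" if "ideal J R" "M \<subseteq> J" "J \<subseteq> carrier R" for J
      using that max[of J] ideal.one_imp_carrier[of J R] M by (auto simp: A_def)
  qed
  then show ?thesis using M by (auto simp: A_def)
qed

text \<open>
  If \<open>b\<close> were not a unit, it would lie in a maximal ideal. That ideal also contains \<open>a\<close> and \<open>c\<close>, and
  hence \<open>\<one>\<close>.
\<close>

lemma unit_of_jacobson_sum:
  assumes "a \<in> jacobson_radical R" "c \<in> jacobson_radical R"
    and car: "b \<in> carrier R" "x \<in> carrier R" "y \<in> carrier R" "z \<in> carrier R"
    and sum: "a \<otimes> x \<oplus> b \<otimes> y \<oplus> c \<otimes> z = \<one>"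
  shows "\<exists>s\<in>carrier R. b \<otimes> s = \<one>"
proof (rule ccontr)
  assume non: "\<not> ?thesis"
  have "\<one> \<notin> PIdl b"
    using non car by (auto simp: cgenideal_def m_comm)
  then obtain M where M: "maximalideal M R" "PIdl b \<subseteq> M"
    using exists_maximalideal[OF cgenideal_ideal] car by blast
  interpret M: maximalideal M R by (rule M)
  have "a \<in> M" "c \<in> M" using assms M by (auto simp: jacobson_radical_def)
  moreover have "b \<in> M" using M cgenideal_self car by blast
  ultimately have "\<one> \<in> M"
    unfolding sum[symmetric] using car by (intro M.a_closed M.I_r_closed)
  then show False using M.one_imp_carrier M.I_notcarr by simp
qed

text \<open>
  The elementwise form of the condition. The sum of the two principal ideals is everything as soon
  as it contains \<open>\<one>\<close>.
\<close>

lemma stable_range_1D: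
  assumes "stable_range_1 R"
    and car: "a \<in> carrier R" "b \<in> carrier R" "x \<in> carrier R" "y \<in> carrier R"
    and sum: "a \<otimes> x \<oplus> b \<otimes> y = \<one>"
  shows "\<exists>t\<in>carrier R. \<exists>u\<in>carrier R. (a \<oplus> b \<otimes> t) \<otimes> u = \<one>"
proof -
  have "PIdl a <+> PIdl b = carrier R"
  proof (rule ideal.one_imp_carrier)
    show "ideal (PIdl a <+> PIdl b) R"
      using car by (intro add_ideals cgenideal_ideal)
    have "a \<otimes> x \<in> PIdl a" "b \<otimes> y \<in> PIdl b"
      unfolding cgenideal_def using car m_comm by blast+
    then show "\<one> \<in> PIdl a <+> PIdl b"
      unfolding sum[symmetric] set_add_def' by blast
  qed
  then show ?thesis
    using assms(1) car Units_r_inv_ex unfolding stable_range_1_def by metis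
qed

text \<open>
  The relation descends to \<open>R/cR\<close>, where stable range 1 yields a unit. Lifting it and its inverse
  leaves an error term in \<open>cR\<close>.
\<close>

lemma stable_range_1_quotient_lift:
  assumes sr: "stable_range_1 (R Quot (PIdl c))"
    and car: "a \<in> carrier R" "b \<in> carrier R" "c \<in> carrier R"
      "x \<in> carrier R" "y \<in> carrier R" "z \<in> carrier R"
    and sum: "a \<otimes> x \<oplus> b \<otimes> y \<oplus> c \<otimes> z = \<one>"
  shows "\<exists>t\<in>carrier R. \<exists>u\<in>carrier R. \<exists>v\<in>carrier R.
    (a \<oplus> b \<otimes> t) \<otimes> u \<oplus> c \<otimes> v = \<one>"
proof -
  let ?I = "PIdl c" and ?Q = "R Quot (PIdl c)"
  let ?h = "\<lambda>r. ?I +> r"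
  have I: "ideal ?I R" by (rule cgenideal_ideal) fact
  have zero: "\<zero>\<^bsub>?Q\<^esub> = ?I" by (simp add: FactRing_def)
  interpret Q: cring ?Q by (rule ideal.quotient_is_cring[OF I is_cring])
  interpret h: ring_hom_ring R ?Q ?h by (rule ideal.rcos_ring_hom_ring[OF I])
  have surj: "\<exists>r\<in>carrier R. X = ?h r" if "X \<in> carrier ?Q" for X
    using that unfolding FactRing_def A_RCOSETS_def' by simp
  have ker: "?h r = \<zero>\<^bsub>?Q\<^esub> \<longleftrightarrow> r \<in> ?I" if "r \<in> carrier R" for r
    unfolding zero using that ideal.rcos_const_imp_mem[OF I] a_rcos_zero[OF I] by metis
  have hc: "?h c = \<zero>\<^bsub>?Q\<^esub>" using ker[of c] cgenideal_self car by simp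
  have one: "?h a \<otimes>\<^bsub>?Q\<^esub> ?h x \<oplus>\<^bsub>?Q\<^esub> ?h b \<otimes>\<^bsub>?Q\<^esub> ?h y = \<one>\<^bsub>?Q\<^esub>"
    using arg_cong[OF sum, of ?h] car hc by simp
  have hcar: "?h a \<in> carrier ?Q" "?h b \<in> carrier ?Q" "?h x \<in> carrier ?Q" "?h y \<in> carrier ?Q"
    using car by (auto intro: h.hom_closed)
  obtain T U where T: "T \<in> carrier ?Q" and U: "U \<in> carrier ?Q"
    "(?h a \<oplus>\<^bsub>?Q\<^esub> ?h b \<otimes>\<^bsub>?Q\<^esub> T) \<otimes>\<^bsub>?Q\<^esub> U = \<one>\<^bsub>?Q\<^esub>"
    using Q.stable_range_1D[OF sr hcar one] by metis
  obtain t u where tu: "t \<in> carrier R" "T = ?h t" "u \<in> carrier R" "U = ?h u"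
    using surj T U(1) by metis
  have "?h (\<one> \<ominus> (a \<oplus> b \<otimes> t) \<otimes> u) = \<one>\<^bsub>?Q\<^esub> \<ominus>\<^bsub>?Q\<^esub> (?h a \<oplus>\<^bsub>?Q\<^esub> ?h b \<otimes>\<^bsub>?Q\<^esub> T) \<otimes>\<^bsub>?Q\<^esub> U"
    using car tu by (simp add: a_minus_def)
  also have "\<dots> = \<zero>\<^bsub>?Q\<^esub>" using U(2) by (simp add: a_minus_def Q.r_neg)
  finally have "\<one> \<ominus> (a \<oplus> b \<otimes> t) \<otimes> u \<in> ?I" using ker car tu by simp
  then obtain v where v: "v \<in> carrier R" "\<one> \<ominus> (a \<oplus> b \<otimes> t) \<otimes> u = v \<otimes> c"
    by (auto simp: cgenideal_def)
  have "(a \<oplus> b \<otimes> t) \<otimes> u \<oplus> c \<otimes> v = (a \<oplus> b \<otimes> t) \<otimes> u \<oplus> (\<one> \<ominus> (a \<oplus> b \<otimes> t) \<otimes> u)"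
    using v car by (simp add: m_comm)
  also have "\<dots> = \<one>" using car tu by (simp add: cring_normalize)
  finally show ?thesis using tu v by blast
qed

end

section \<open>Finite sums\<close>

context cring
begin

lemma finsum_lessThan_Suc:
  "f \<in> {..<Suc n} \<rightarrow> carrier R \<Longrightarrow> (\<Oplus>k\<in>{..<Suc n}. f k) = f n \<oplus> (\<Oplus>k\<in>{..<n}. f k)"
  unfolding lessThan_Suc by (rule finsum_insert) auto

lemma finsum_lessThan_1: "f 0 \<in> carrier R \<Longrightarrow> (\<Oplus>k\<in>{..<Suc 0}. f k) = f 0"
  using finsum_lessThan_Suc[of f 0] by simp

lemma finsum_lessThan_2:
  "f 0 \<in> carrier R \<Longrightarrow> f (Suc 0) \<in> carrier R \<Longrightarrow> (\<Oplus>k\<in>{..<2}. f k) = f 0 \<oplus> f (Suc 0)"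
  by (simp add: numeral_2_eq_2 lessThan_Suc a_comm)

lemma finsum_lessThan_add:
  "f \<in> {..<m + n :: nat} \<rightarrow> carrier R \<Longrightarrow>
    (\<Oplus>k\<in>{..<m + n}. f k) = (\<Oplus>k\<in>{..<m}. f k) \<oplus> (\<Oplus>k\<in>{..<n}. f (m + k))"
proof (induction n)
  case 0
  then show ?case by (simp add: finsum_closed)
next
  case (Suc n)
  have c: "(\<lambda>k. f (m + k)) \<in> {..<n} \<rightarrow> carrier R" "f \<in> {..<m} \<rightarrow> carrier R" "f (m + n) \<in> carrier R"
    "f \<in> {..<m+n} \<rightarrow> carrier R" "(\<lambda>k. f (m + k)) \<in> {..<Suc n} \<rightarrow> carrier R"
    "f \<in> {..<Suc (m + n)} \<rightarrow> carrier R"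
    using Suc.prems by auto
  show ?case
    using c Suc.IH by (simp add: finsum_lessThan_Suc a_lcomm)
qed

lemma finsum_swap:
  assumes "finite A" "finite B" "\<And>i j. i \<in> A \<Longrightarrow> j \<in> B \<Longrightarrow> f i j \<in> carrier R"
  shows "(\<Oplus>i\<in>A. \<Oplus>j\<in>B. f i j) = (\<Oplus>j\<in>B. \<Oplus>i\<in>A. f i j)"
  using assms(1,3)
proof (induction A rule: finite_induct)
  case empty
  then show ?case using assms(2) by simp
next
  case (insert a A)
  have "(\<Oplus>i\<in>insert a A. \<Oplus>j\<in>B. f i j) = (\<Oplus>j\<in>B. f a j) \<oplus> (\<Oplus>j\<in>B. \<Oplus>i\<in>A. f i j)"
    using insert by (subst finsum_insert) (auto intro!: finsum_closed)
  also have "\<dots> = (\<Oplus>j\<in>B. f a j \<oplus> (\<Oplus>i\<in>A. f i j))"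
    using insert by (subst finsum_addf) (auto intro!: finsum_closed)
  also have "\<dots> = (\<Oplus>j\<in>B. \<Oplus>i\<in>insert a A. f i j)"
    using insert by (intro finsum_cong') (auto intro!: finsum_closed)
  finally show ?case .
qed

lemma finsum_zero_on:
  "(\<And>k. k \<in> A \<Longrightarrow> f k = \<zero>) \<Longrightarrow> (\<Oplus>k\<in>A. f k) = \<zero>"
  using add.finprod_one_eqI by auto

lemma divides_finsum:
  assumes "finite A" "d \<in> carrier R" "\<And>k. k \<in> A \<Longrightarrow> f k \<in> carrier R" "\<And>k. k \<in> A \<Longrightarrow> d divides f k"
  shows "d divides (\<Oplus>k\<in>A. f k)"
  using assms(1,3,4)
proof (induction A rule: finite_induct)
  case empty
  have "\<zero> = d \<otimes> \<zero>" using assms(2) by simp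
  then show ?case unfolding factor_def by auto
next
  case (insert a A)
  then obtain x y where "x \<in> carrier R" "f a = d \<otimes> x" "y \<in> carrier R" "(\<Oplus>k\<in>A. f k) = d \<otimes> y"
    unfolding factor_def by (metis insertCI)
  moreover have "(\<Oplus>k\<in>insert a A. f k) = f a \<oplus> (\<Oplus>k\<in>A. f k)"
    using insert by (intro finsum_insert) auto
  ultimately have "(\<Oplus>k\<in>insert a A. f k) = d \<otimes> (x \<oplus> y)" "x \<oplus> y \<in> carrier R"
    using assms(2) by (simp_all add: r_distr)
  then show ?case unfolding factor_def by blast
qed

section \<open>Matrices over a ring structure\<close>

abbreviation mult_mat (infixl "\<odot>" 70) where "A \<odot> B \<equiv> mat_times R A B"
abbreviation GL where "GL n \<equiv> invertible_mats R n"

lemma mats_iff: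
  "A \<in> mats R m n \<longleftrightarrow>
    dim_row A = m \<and> dim_col A = n \<and> (\<forall>i<m. \<forall>j<n. A $$ (i, j) \<in> carrier R)"
proof -
  have "elements_mat A \<subseteq> carrier R \<longleftrightarrow>
    (\<forall>i<dim_row A. \<forall>j<dim_col A. A $$ (i, j) \<in> carrier R)"
    by (blast intro: elements_matI[OF carrier_matI])
  then show ?thesis unfolding mats_def by auto
qed

lemma mats_dim: "A \<in> mats R m n \<Longrightarrow> dim_row A = m" "A \<in> mats R m n \<Longrightarrow> dim_col A = n"
  and mats_entry: "A \<in> mats R m n \<Longrightarrow> i < m \<Longrightarrow> j < n \<Longrightarrow> A $$ (i, j) \<in> carrier R"
  by (auto simp: mats_iff)

lemma mat_times_dim [simp]:
  "dim_row (A \<odot> B) = dim_row A" "dim_col (A \<odot> B) = dim_col B"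
  by (simp_all add: mat_times_def)

lemma mat_times_index:
  "i < dim_row A \<Longrightarrow> j < dim_col B \<Longrightarrow>
    (A \<odot> B) $$ (i, j) = (\<Oplus>k\<in>{..<dim_col A}. A $$ (i, k) \<otimes> B $$ (k, j))"
  by (simp add: mat_times_def)

lemma mat_times_closed:
  "A \<in> mats R m n \<Longrightarrow> B \<in> mats R n p \<Longrightarrow> A \<odot> B \<in> mats R m p"
  by (auto simp: mats_iff mat_times_index intro!: finsum_closed)

lemma mat_times_assoc:
  assumes A: "A \<in> mats R m n" and B: "B \<in> mats R n p" and C: "C \<in> mats R p q"
  shows "A \<odot> B \<odot> C = A \<odot> (B \<odot> C)"
proof (rule eq_matI)
  fix i j assume "i < dim_row (A \<odot> (B \<odot> C))" "j < dim_col (A \<odot> (B \<odot> C))"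
  then have ij: "i < m" "j < q" using mats_dim[OF A] mats_dim[OF C] by auto
  note dims = mats_dim[OF A] mats_dim[OF B] mats_dim[OF C]
  note ent = mats_entry[OF A] mats_entry[OF B] mats_entry[OF C]
  have "(A \<odot> B \<odot> C) $$ (i, j)
      = (\<Oplus>l\<in>{..<p}. (\<Oplus>k\<in>{..<n}. A $$ (i, k) \<otimes> B $$ (k, l)) \<otimes> C $$ (l, j))"
    using ij ent by (auto simp: mat_times_index dims intro!: finsum_cong' finsum_closed)
  also have "\<dots> = (\<Oplus>l\<in>{..<p}. \<Oplus>k\<in>{..<n}. A $$ (i, k) \<otimes> B $$ (k, l) \<otimes> C $$ (l, j))"
    using ij ent by (intro finsum_cong' finsum_ldistr) (auto intro!: finsum_closed)
  also have "\<dots> = (\<Oplus>k\<in>{..<n}. \<Oplus>l\<in>{..<p}. A $$ (i, k) \<otimes> B $$ (k, l) \<otimes> C $$ (l, j))"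
    using ij ent by (intro finsum_swap) auto
  also have "\<dots> = (\<Oplus>k\<in>{..<n}. A $$ (i, k) \<otimes> (\<Oplus>l\<in>{..<p}. B $$ (k, l) \<otimes> C $$ (l, j)))"
    using ij ent
    by (auto intro!: finsum_cong' finsum_closed simp: finsum_rdistr m_assoc)
  also have "\<dots> = (A \<odot> (B \<odot> C)) $$ (i, j)"
    using ij ent by (auto simp: mat_times_index dims intro!: finsum_cong' finsum_closed)
  finally show "(A \<odot> B \<odot> C) $$ (i, j) = (A \<odot> (B \<odot> C)) $$ (i, j)" .
qed auto

lemma mat_times_regroup:
  assumes P: "P \<in> mats R k l" and P': "P' \<in> mats R l m" and A: "A \<in> mats R m n"
    and Q: "Q \<in> mats R n p" and Q': "Q' \<in> mats R p q"
  shows "P \<odot> (P' \<odot> A \<odot> Q) \<odot> Q' = (P \<odot> P') \<odot> A \<odot> (Q \<odot> Q')"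
proof -
  note P'A = mat_times_closed[OF P' A] and PP' = mat_times_closed[OF P P']
  note PP'A = mat_times_closed[OF PP' A]
  have "P \<odot> (P' \<odot> A \<odot> Q) = (P \<odot> P') \<odot> A \<odot> Q"
    unfolding mat_times_assoc[OF P P'A Q, symmetric] mat_times_assoc[OF P P' A] ..
  then show ?thesis using mat_times_assoc[OF PP'A Q Q'] by simp
qed

lemma mat_one_closed: "mat_one R n \<in> mats R n n"
  by (auto simp: mats_iff mat_one_def)

lemma mat_one_dim [simp]: "dim_row (mat_one R n) = n" "dim_col (mat_one R n) = n"
  by (simp_all add: mat_one_def)

lemma finsum_delta:
  assumes "i \<in> A" "finite A" "f i \<in> carrier R" "\<And>k. k \<in> A \<Longrightarrow> k \<noteq> i \<Longrightarrow> f k = \<zero>"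
  shows "(\<Oplus>k\<in>A. f k) = f i"
proof -
  have "(\<Oplus>k\<in>A. f k) = (\<Oplus>k\<in>A. if i = k then f i else \<zero>)"
    using assms by (intro finsum_cong') auto
  also have "\<dots> = f i" using assms finsum_singleton[of i A "\<lambda>_. f i"] by auto
  finally show ?thesis .
qed

lemma mat_times_one_left: "A \<in> mats R m n \<Longrightarrow> mat_one R m \<odot> A = A"
proof (rule eq_matI)
  fix i j assume A: "A \<in> mats R m n" and ij: "i < dim_row A" "j < dim_col A"
  then have A_row: "i < m" by (simp add: mats_iff)
  have "(mat_one R m \<odot> A) $$ (i, j) = mat_one R m $$ (i, i) \<otimes> A $$ (i, j)"
    using A ij unfolding mat_times_index[of i "mat_one R m" j A, simplified, OF A_row ij(2)]
    by (intro finsum_delta) (auto simp: mats_iff mat_one_def)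
  then show "(mat_one R m \<odot> A) $$ (i, j) = A $$ (i, j)"
    using A ij by (simp add: mats_iff mat_one_def)
qed (auto simp: mats_iff)

lemma transpose_mats: "A \<in> mats R m n \<Longrightarrow> transpose_mat A \<in> mats R n m"
  by (auto simp: mats_iff)

lemma transpose_mat_times:
  assumes A: "A \<in> mats R m n" and B: "B \<in> mats R n p"
  shows "transpose_mat (A \<odot> B) = transpose_mat B \<odot> transpose_mat A"
proof (rule eq_matI)
  fix i j assume "i < dim_row (transpose_mat B \<odot> transpose_mat A)"
    "j < dim_col (transpose_mat B \<odot> transpose_mat A)"
  then show "transpose_mat (A \<odot> B) $$ (i, j) = (transpose_mat B \<odot> transpose_mat A) $$ (i, j)"
    using A B by (auto simp: mats_iff mat_times_index m_comm intro!: finsum_cong')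
qed (use A B in auto)

lemma transpose_mat_one: "transpose_mat (mat_one R n) = mat_one R n"
  by (auto simp: mat_one_def)

lemma mat_times_one_right:
  assumes "A \<in> mats R m n" shows "A \<odot> mat_one R n = A"
proof -
  have "transpose_mat (A \<odot> mat_one R n) = transpose_mat A"
    using transpose_mat_times[OF assms mat_one_closed] mat_times_one_left[OF transpose_mats[OF assms]]
    by (simp add: transpose_mat_one)
  then show ?thesis by (metis transpose_transpose)
qed

lemma GL_I:
  "P \<in> mats R n n \<Longrightarrow> P' \<in> mats R n n \<Longrightarrow> P \<odot> P' = mat_one R n \<Longrightarrow> P' \<odot> P = mat_one R n \<Longrightarrow> P \<in> GL n"
  unfolding invertible_mats_def by blast

lemma GL_E:
  assumes "P \<in> GL n"
  obtains P' where "P \<in> mats R n n" "P' \<in> mats R n n" "P \<odot> P' = mat_one R n" "P' \<odot> P = mat_one R n"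
  using assms unfolding invertible_mats_def by blast

lemma GL_mats: "P \<in> GL n \<Longrightarrow> P \<in> mats R n n"
  by (simp add: invertible_mats_def)

lemma GL_one: "mat_one R n \<in> GL n"
  using GL_I[OF mat_one_closed mat_one_closed] mat_times_one_left[OF mat_one_closed] by simp

lemma GL_times:
  assumes "P \<in> GL n" "Q \<in> GL n" shows "P \<odot> Q \<in> GL n"
proof -
  obtain P' where P: "P \<in> mats R n n" "P' \<in> mats R n n" "P \<odot> P' = mat_one R n" "P' \<odot> P = mat_one R n"
    using assms(1) by (rule GL_E)
  obtain Q' where Q: "Q \<in> mats R n n" "Q' \<in> mats R n n" "Q \<odot> Q' = mat_one R n" "Q' \<odot> Q = mat_one R n"
    using assms(2) by (rule GL_E)
  have cancel: "A \<odot> B \<odot> (B' \<odot> A') = mat_one R n"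
    if "A \<in> mats R n n" "A' \<in> mats R n n" "B \<in> mats R n n" "B' \<in> mats R n n"
      "A \<odot> A' = mat_one R n" "B \<odot> B' = mat_one R n" for A A' B B'
  proof -
    have "A \<odot> B \<odot> (B' \<odot> A') = A \<odot> (B \<odot> B' \<odot> A')"
      using mat_times_assoc[OF that(1,3) mat_times_closed[OF that(4,2)]]
        mat_times_assoc[OF that(3,4,2)] by simp
    then show ?thesis using mat_times_one_left[OF that(2)] that(5,6) by simp
  qed
  show ?thesis
    using P Q by (intro GL_I[of _ n "Q' \<odot> P'"] cancel mat_times_closed)
qed

lemma GL_transpose:
  assumes "P \<in> GL n" shows "transpose_mat P \<in> GL n"
proof -
  obtain P' where P: "P \<in> mats R n n" "P' \<in> mats R n n" "P \<odot> P' = mat_one R n" "P' \<odot> P = mat_one R n"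
    using assms(1) by (rule GL_E)
  show ?thesis
    using P by (intro GL_I[of _ n "transpose_mat P'"] transpose_mats)
      (simp_all add: transpose_mat_one flip: transpose_mat_times)
qed

text \<open>
  The block diagonal matrix with possibly rectangular blocks. It serves both to let an operation
  act on some of the rows only and to describe a matrix whose first row and column are cleared.
\<close>

definition dsum where
  "dsum A B = mat (dim_row A + dim_row B) (dim_col A + dim_col B)
    (\<lambda>(i, j). if i < dim_row A then (if j < dim_col A then A $$ (i, j) else \<zero>)
      else (if j < dim_col A then \<zero> else B $$ (i - dim_row A, j - dim_col A)))"

lemma dsum_dim [simp]:
  "dim_row (dsum A B) = dim_row A + dim_row B" "dim_col (dsum A B) = dim_col A + dim_col B"
  by (simp_all add: dsum_def)

lemma dsum_closed:
  "A \<in> mats R m n \<Longrightarrow> B \<in> mats R p q \<Longrightarrow> dsum A B \<in> mats R (m + p) (n + q)"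
  by (auto simp: mats_iff dsum_def)

definition row_block where
  "row_block k l A = mat l (dim_col A) (\<lambda>(i, j). A $$ (k + i, j))"

lemma row_block_closed: "A \<in> mats R m n \<Longrightarrow> k + l \<le> m \<Longrightarrow> row_block k l A \<in> mats R l n"
  by (auto simp: mats_iff row_block_def)

lemma row_block_times:
  assumes "A \<in> mats R m n" "B \<in> mats R n p" "k + l \<le> m"
  shows "row_block k l (A \<odot> B) = row_block k l A \<odot> B"
proof (rule eq_matI)
  fix i j assume "i < dim_row (row_block k l A \<odot> B)" "j < dim_col (row_block k l A \<odot> B)"
  then show "row_block k l (A \<odot> B) $$ (i, j) = (row_block k l A \<odot> B) $$ (i, j)"
    using assms by (auto simp: mats_iff row_block_def mat_times_index intro!: finsum_cong')
qed (auto simp: row_block_def)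

lemma dsum_times_index:
  assumes P: "P \<in> mats R m n" and Q: "Q \<in> mats R p q" and A: "A \<in> mats R (n + q) r"
    and ij: "i < m + p" "j < r"
  shows "(dsum P Q \<odot> A) $$ (i, j) =
    (if i < m then (P \<odot> row_block 0 n A) $$ (i, j) else (Q \<odot> row_block n q A) $$ (i - m, j))"
proof -
  let ?f = "\<lambda>k. dsum P Q $$ (i, k) \<otimes> A $$ (k, j)"
  note dims = mats_dim[OF P] mats_dim[OF Q] mats_dim[OF A]
  note ent = mats_entry[OF P] mats_entry[OF Q] mats_entry[OF A]
  have f: "?f \<in> {..<n + q} \<rightarrow> carrier R"
    using mats_entry[OF dsum_closed[OF P Q]] ent ij by auto
  have "(dsum P Q \<odot> A) $$ (i, j) = (\<Oplus>k\<in>{..<n + q}. ?f k)"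
    using ij dims by (subst mat_times_index) auto
  also have "\<dots> = (\<Oplus>k\<in>{..<n}. ?f k) \<oplus> (\<Oplus>k\<in>{..<q}. ?f (n + k))"
    by (rule finsum_lessThan_add[OF f])
  also have "\<dots> = (if i < m then (P \<odot> row_block 0 n A) $$ (i, j) else (Q \<odot> row_block n q A) $$ (i - m, j))"
  proof (cases "i < m")
    case True
    have "(\<Oplus>k\<in>{..<q}. ?f (n + k)) = \<zero>"
      using True ent ij dims by (intro finsum_zero_on) (auto simp: dsum_def)
    moreover have "(\<Oplus>k\<in>{..<n}. ?f k) = (P \<odot> row_block 0 n A) $$ (i, j)"
      using True ent ij dims
      by (auto simp: mat_times_index row_block_def dsum_def intro!: finsum_cong')
    moreover have "(P \<odot> row_block 0 n A) $$ (i, j) \<in> carrier R"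
      using mats_entry[OF mat_times_closed[OF P row_block_closed[OF A]]] True ij by simp
    ultimately show ?thesis using True by simp
  next
    case False
    have "(\<Oplus>k\<in>{..<n}. ?f k) = \<zero>"
      using False ent ij dims by (intro finsum_zero_on) (auto simp: dsum_def)
    moreover have "(\<Oplus>k\<in>{..<q}. ?f (n + k)) = (Q \<odot> row_block n q A) $$ (i - m, j)"
      using False ent ij dims
      by (auto simp: mat_times_index row_block_def dsum_def intro!: finsum_cong')
    moreover have "(Q \<odot> row_block n q A) $$ (i - m, j) \<in> carrier R"
      using mats_entry[OF mat_times_closed[OF Q row_block_closed[OF A]]] False ij by simp
    ultimately show ?thesis using False by simp
  qed
  finally show ?thesis .
qed

lemma row_block_dsum_times:
  assumes P: "P \<in> mats R m n" and Q: "Q \<in> mats R p q" and A: "A \<in> mats R (n + q) r"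
  shows "row_block 0 m (dsum P Q \<odot> A) = P \<odot> row_block 0 n A" (is ?top)
    and "row_block m p (dsum P Q \<odot> A) = Q \<odot> row_block n q A" (is ?bot)
proof -
  note dims = mats_dim[OF P] mats_dim[OF Q] mats_dim[OF A]
  have X: "dim_row (P \<odot> row_block 0 n A) = m" "dim_col (P \<odot> row_block 0 n A) = r"
    "dim_row (Q \<odot> row_block n q A) = p" "dim_col (Q \<odot> row_block n q A) = r"
    "dim_row (row_block 0 m (dsum P Q \<odot> A)) = m" "dim_col (row_block 0 m (dsum P Q \<odot> A)) = r"
    "dim_row (row_block m p (dsum P Q \<odot> A)) = p" "dim_col (row_block m p (dsum P Q \<odot> A)) = r"
    using dims by (simp_all add: row_block_def)
  show ?top
  proof (rule eq_matI)
    fix i j assume "i < dim_row (P \<odot> row_block 0 n A)" "j < dim_col (P \<odot> row_block 0 n A)"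
    then show "row_block 0 m (dsum P Q \<odot> A) $$ (i, j) = (P \<odot> row_block 0 n A) $$ (i, j)"
      unfolding X using dsum_times_index[OF assms, of i j] dims by (simp add: row_block_def)
  qed (simp_all only: X)
  show ?bot
  proof (rule eq_matI)
    fix i j assume "i < dim_row (Q \<odot> row_block n q A)" "j < dim_col (Q \<odot> row_block n q A)"
    then show "row_block m p (dsum P Q \<odot> A) $$ (i, j) = (Q \<odot> row_block n q A) $$ (i, j)"
      unfolding X using dsum_times_index[OF assms, of "m + i" j] dims by (simp add: row_block_def)
  qed (simp_all only: X)
qed

lemma dsum_times_dsum:
  assumes A: "A \<in> mats R m n" and B: "B \<in> mats R p q" and C: "C \<in> mats R n r" and D: "D \<in> mats R q s"
  shows "dsum A B \<odot> dsum C D = dsum (A \<odot> C) (B \<odot> D)"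
proof (rule eq_matI)
  note dims = mats_dim[OF A] mats_dim[OF B] mats_dim[OF C] mats_dim[OF D]
  note ent = mats_entry[OF A] mats_entry[OF B] mats_entry[OF C] mats_entry[OF D]
  fix i j assume "i < dim_row (dsum (A \<odot> C) (B \<odot> D))" "j < dim_col (dsum (A \<odot> C) (B \<odot> D))"
  then have ij: "i < m + p" "j < r + s" using dims by auto
  have top: "(A \<odot> row_block 0 n (dsum C D)) $$ (i, j) = dsum (A \<odot> C) (B \<odot> D) $$ (i, j)" if "i < m"
    using that ij ent by (cases "j < r")
     (auto simp: dims mat_times_index row_block_def dsum_def intro!: finsum_cong' finsum_zero_on)
  have bot: "(B \<odot> row_block n q (dsum C D)) $$ (i - m, j) = dsum (A \<odot> C) (B \<odot> D) $$ (i, j)" if "\<not> i < m"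
    using that ij ent by (cases "j < r")
     (auto simp: dims mat_times_index row_block_def dsum_def intro!: finsum_cong' finsum_zero_on)
  show "(dsum A B \<odot> dsum C D) $$ (i, j) = dsum (A \<odot> C) (B \<odot> D) $$ (i, j)"
    using dsum_times_index[OF A B dsum_closed[OF C D] ij] top bot by simp
qed simp_all

lemma dsum_one: "dsum (mat_one R m) (mat_one R n) = mat_one R (m + n)"
  by (rule eq_matI) (auto simp: dsum_def mat_one_def)

lemma GL_dsum:
  assumes "P \<in> GL m" "Q \<in> GL n" shows "dsum P Q \<in> GL (m + n)"
proof -
  obtain P' where P: "P \<in> mats R m m" "P' \<in> mats R m m" "P \<odot> P' = mat_one R m" "P' \<odot> P = mat_one R m"
    using assms(1) by (rule GL_E)
  obtain Q' where Q: "Q \<in> mats R n n" "Q' \<in> mats R n n" "Q \<odot> Q' = mat_one R n" "Q' \<odot> Q = mat_one R n"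
    using assms(2) by (rule GL_E)
  show ?thesis
    using P Q by (intro GL_I[of _ _ "dsum P' Q'"]) (auto simp: dsum_closed dsum_times_dsum dsum_one)
qed

definition divides_mat where
  "divides_mat d A \<longleftrightarrow> (\<forall>i<dim_row A. \<forall>j<dim_col A. d divides A $$ (i, j))"

lemma divides_mult_left:
  "d divides x \<Longrightarrow> d \<in> carrier R \<Longrightarrow> x \<in> carrier R \<Longrightarrow> y \<in> carrier R \<Longrightarrow> d divides y \<otimes> x"
  unfolding factor_def by (metis m_closed m_lcomm)

lemma divides_mult_right:
  "d divides x \<Longrightarrow> d \<in> carrier R \<Longrightarrow> x \<in> carrier R \<Longrightarrow> y \<in> carrier R \<Longrightarrow> d divides x \<otimes> y"
  unfolding factor_def by (metis m_closed m_assoc)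

lemma divides_mat_times_left:
  assumes "d \<in> carrier R" "P \<in> mats R m n" "A \<in> mats R n p" "divides_mat d A"
  shows "divides_mat d (P \<odot> A)"
  using assms unfolding divides_mat_def
  by (auto simp: mats_iff mat_times_index intro!: divides_finsum divides_mult_left)

lemma divides_mat_times_right:
  assumes "d \<in> carrier R" "A \<in> mats R m n" "Q \<in> mats R n p" "divides_mat d A"
  shows "divides_mat d (A \<odot> Q)"
  using assms unfolding divides_mat_def
  by (auto simp: mats_iff mat_times_index intro!: divides_finsum divides_mult_right)

lemma GL_cancel_left:
  assumes "P \<in> GL m" "A \<in> mats R m n"
  obtains P' where "P' \<in> mats R m m" "P' \<odot> (P \<odot> A) = A"
proof -
  obtain P' where P: "P \<in> mats R m m" "P' \<in> mats R m m" "P' \<odot> P = mat_one R m"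
    using assms(1) by (rule GL_E)
  then have "P' \<odot> (P \<odot> A) = A"
    using mat_times_assoc[OF P(2,1) assms(2)] mat_times_one_left[OF assms(2)] by simp
  then show thesis using that P by blast
qed

lemma GL_cancel_right:
  assumes "Q \<in> GL n" "A \<in> mats R m n"
  obtains Q' where "Q' \<in> mats R n n" "A \<odot> Q \<odot> Q' = A"
proof -
  obtain Q' where Q: "Q \<in> mats R n n" "Q' \<in> mats R n n" "Q \<odot> Q' = mat_one R n"
    using assms(1) by (rule GL_E)
  then have "A \<odot> Q \<odot> Q' = A"
    using mat_times_assoc[OF assms(2) Q(1,2)] mat_times_one_right[OF assms(2)] by simp
  then show thesis using that Q by blast
qed

lemma divides_mat_GL_left:
  assumes "P \<in> GL m" "A \<in> mats R m n" "d \<in> carrier R"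
  shows "divides_mat d (P \<odot> A) \<longleftrightarrow> divides_mat d A"
proof
  note P = GL_mats[OF assms(1)]
  obtain P' where P': "P' \<in> mats R m m" "P' \<odot> (P \<odot> A) = A"
    using GL_cancel_left[OF assms(1,2)] .
  show "divides_mat d A" if "divides_mat d (P \<odot> A)"
    using divides_mat_times_left[OF assms(3) P'(1) mat_times_closed[OF P assms(2)] that] P'(2)
    by simp
  show "divides_mat d (P \<odot> A)" if "divides_mat d A"
    by (rule divides_mat_times_left[OF assms(3) P assms(2) that])
qed

lemma divides_mat_GL_right:
  assumes "Q \<in> GL n" "A \<in> mats R m n" "d \<in> carrier R"
  shows "divides_mat d (A \<odot> Q) \<longleftrightarrow> divides_mat d A"
proof
  note Q = GL_mats[OF assms(1)]
  obtain Q' where Q': "Q' \<in> mats R n n" "A \<odot> Q \<odot> Q' = A"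
    using GL_cancel_right[OF assms(1,2)] .
  show "divides_mat d A" if "divides_mat d (A \<odot> Q)"
    using divides_mat_times_right[OF assms(3) mat_times_closed[OF assms(2) Q] Q'(1) that] Q'(2)
    by simp
  show "divides_mat d (A \<odot> Q)" if "divides_mat d A"
    by (rule divides_mat_times_right[OF assms(3,2) Q that])
qed

text \<open>
  The matrix of the row operations that add \<open>c i\<close> times row 0 to row \<open>i\<close>,
  for \<open>i > 0\<close>.
\<close>

definition shear where
  "shear n c = mat n n (\<lambda>(i, j). if i = j then \<one> else if j = 0 then c i else \<zero>)"

lemma shear_closed: "c \<in> {1..<n} \<rightarrow> carrier R \<Longrightarrow> shear n c \<in> mats R n n"
  by (auto simp: mats_iff shear_def)

lemma shear_times_index:
  assumes A: "A \<in> mats R (Suc m) n" and c: "c \<in> {1..<Suc m} \<rightarrow> carrier R" and "i < Suc m" "j < n"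
  shows "(shear (Suc m) c \<odot> A) $$ (i, j)
    = (if i = 0 then A $$ (0, j) else A $$ (i, j) \<oplus> c i \<otimes> A $$ (0, j))"
proof -
  let ?f = "\<lambda>k. shear (Suc m) c $$ (i, k) \<otimes> A $$ (k, j)"
  have f: "?f \<in> {..<Suc m} \<rightarrow> carrier R"
    using assms shear_closed[OF c] by (auto simp: mats_iff)
  have "(shear (Suc m) c \<odot> A) $$ (i, j) = (\<Oplus>k\<in>{..<1 + m}. ?f k)"
    using assms by (subst mat_times_index) (auto simp: mats_iff shear_def)
  also have "\<dots> = ?f 0 \<oplus> (\<Oplus>k\<in>{..<m}. ?f (1 + k))"
    using f by (subst finsum_lessThan_add) (auto simp: finsum_lessThan_1 Pi_iff)
  also have "\<dots> = (if i = 0 then A $$ (0, j) else A $$ (i, j) \<oplus> c i \<otimes> A $$ (0, j))"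
  proof (cases i)
    case 0
    then have "(\<Oplus>k\<in>{..<m}. ?f (1 + k)) = \<zero>"
      using assms by (intro finsum_zero_on) (auto simp: shear_def mats_iff)
    then show ?thesis using 0 assms by (auto simp: shear_def mats_iff)
  next
    case (Suc l)
    then have "(\<Oplus>k\<in>{..<m}. ?f (1 + k)) = ?f (1 + l)"
      using assms by (intro finsum_delta) (auto simp: shear_def mats_iff)
    then show ?thesis using Suc assms by (auto simp: shear_def mats_iff a_comm Pi_iff)
  qed
  finally show ?thesis .
qed

text \<open>
  The inverse subtracts the same multiples again.
\<close>

lemma shear_GL:
  assumes c: "c \<in> {1..<Suc m} \<rightarrow> carrier R" shows "shear (Suc m) c \<in> GL (Suc m)"
proof -
  have inv: "shear (Suc m) a \<odot> shear (Suc m) b = mat_one R (Suc m)"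
    if "a \<in> {1..<Suc m} \<rightarrow> carrier R" "b \<in> {1..<Suc m} \<rightarrow> carrier R" "\<And>i. i \<in> {1..<Suc m} \<Longrightarrow> b i \<oplus> a i = \<zero>" for a b
  proof (rule eq_matI)
    fix i j assume "i < dim_row (mat_one R (Suc m))" "j < dim_col (mat_one R (Suc m))"
    then show "(shear (Suc m) a \<odot> shear (Suc m) b) $$ (i, j) = mat_one R (Suc m) $$ (i, j)"
      using that by (subst shear_times_index[OF shear_closed[OF that(2)] that(1)])
        (auto simp: mat_one_def shear_def Pi_iff)
  qed (auto simp: shear_def)
  show ?thesis
    using c by (intro GL_I[of _ _ "shear (Suc m) (\<lambda>i. \<ominus> c i)"] inv shear_closed) (auto simp: l_neg r_neg Pi_iff)
qed

definition mat2 where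
  "mat2 a b c d = mat 2 2 (\<lambda>(i, j). if i = 0 then (if j = 0 then a else b) else (if j = 0 then c else d))"

lemma mat2_closed:
  "a \<in> carrier R \<Longrightarrow> b \<in> carrier R \<Longrightarrow> c \<in> carrier R \<Longrightarrow> d \<in> carrier R \<Longrightarrow> mat2 a b c d \<in> mats R 2 2"
  by (auto simp: mats_iff mat2_def)

text \<open>
  The inverse of a matrix of determinant 1 is its adjugate.
\<close>

lemma mat2_GL:
  assumes car: "a \<in> carrier R" "b \<in> carrier R" "c \<in> carrier R" "d \<in> carrier R"
    and det: "a \<otimes> d \<ominus> b \<otimes> c = \<one>"
  shows "mat2 a b c d \<in> GL 2"
proof -
  have det': "a \<otimes> d \<oplus> \<ominus> (b \<otimes> c) = \<one>" "\<ominus> (b \<otimes> c) \<oplus> a \<otimes> d = \<one>"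
    using det car by (simp_all add: a_minus_def a_comm)
  have less2: "i < 2 \<longleftrightarrow> i = 0 \<or> i = Suc 0" for i :: nat by auto
  show ?thesis
  proof (rule GL_I[of _ 2 "mat2 d (\<ominus> b) (\<ominus> c) a"])
    show "mat2 a b c d \<odot> mat2 d (\<ominus> b) (\<ominus> c) a = mat_one R 2"
    proof (rule eq_matI)
      fix i j assume "i < dim_row (mat_one R 2)" "j < dim_col (mat_one R 2)"
      then show "(mat2 a b c d \<odot> mat2 d (\<ominus> b) (\<ominus> c) a) $$ (i, j) = mat_one R 2 $$ (i, j)"
        using car det' unfolding mat_one_dim less2
        by (auto simp: mat_times_index mat2_def mat_one_def finsum_lessThan_2 cring_normalize)
    qed (simp_all add: mat2_def)
    show "mat2 d (\<ominus> b) (\<ominus> c) a \<odot> mat2 a b c d = mat_one R 2"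
    proof (rule eq_matI)
      fix i j assume "i < dim_row (mat_one R 2)" "j < dim_col (mat_one R 2)"
      then show "(mat2 d (\<ominus> b) (\<ominus> c) a \<odot> mat2 a b c d) $$ (i, j) = mat_one R 2 $$ (i, j)"
        using car det' unfolding mat_one_dim less2
        by (auto simp: mat_times_index mat2_def mat_one_def finsum_lessThan_2 cring_normalize)
    qed (simp_all add: mat2_def)
  qed (use car in \<open>simp_all add: mat2_closed\<close>)
qed

section \<open>Corner entries that divide all entries\<close>

text \<open>
  Such a corner entry generates the ideal of all entries, since it is also a combination of them.
\<close>

definition gcd_pivot where
  "gcd_pivot m n \<longleftrightarrow> (\<forall>A\<in>mats R m n. \<exists>P\<in>GL m. \<exists>Q\<in>GL n. divides_mat ((P \<odot> A \<odot> Q) $$ (0, 0)) A)"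

lemma divides_mat_transpose: "divides_mat d (transpose_mat A) \<longleftrightarrow> divides_mat d A"
  by (auto simp: divides_mat_def)

lemma gcd_pivot_transpose:
  assumes "gcd_pivot m n" "0 < m" "0 < n" shows "gcd_pivot n m"
  unfolding gcd_pivot_def
proof
  fix A assume A: "A \<in> mats R n m"
  then obtain P Q where PQ: "P \<in> GL m" "Q \<in> GL n"
    "divides_mat ((P \<odot> transpose_mat A \<odot> Q) $$ (0, 0)) (transpose_mat A)"
    using assms(1) transpose_mats unfolding gcd_pivot_def by blast
  note P = GL_mats[OF PQ(1)] and Q = GL_mats[OF PQ(2)]
  have "transpose_mat (P \<odot> transpose_mat A \<odot> Q) = transpose_mat Q \<odot> (A \<odot> transpose_mat P)"
    using transpose_mat_times[OF P transpose_mats[OF A]]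
      transpose_mat_times[OF mat_times_closed[OF P transpose_mats[OF A]] Q] by simp
  also have "\<dots> = transpose_mat Q \<odot> A \<odot> transpose_mat P"
    using mat_times_assoc[OF transpose_mats[OF Q] A transpose_mats[OF P]] by simp
  finally have "(transpose_mat Q \<odot> A \<odot> transpose_mat P) $$ (0, 0)
      = transpose_mat (P \<odot> transpose_mat A \<odot> Q) $$ (0, 0)" by simp
  also have "\<dots> = (P \<odot> transpose_mat A \<odot> Q) $$ (0, 0)"
    using assms(2,3) mats_dim[OF P] mats_dim[OF Q] by simp
  finally have "divides_mat ((transpose_mat Q \<odot> A \<odot> transpose_mat P) $$ (0, 0)) A"
    using PQ(3) by (simp add: divides_mat_transpose)
  then show "\<exists>P\<in>GL n. \<exists>Q\<in>GL m. divides_mat ((P \<odot> A \<odot> Q) $$ (0, 0)) A"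
    using PQ GL_transpose by blast
qed

lemma row_block_00: "0 < l \<Longrightarrow> 0 < dim_col A \<Longrightarrow> row_block 0 l A $$ (0, 0) = A $$ (0, 0)"
  by (simp add: row_block_def)

text \<open>
  An operation on all rows but the first puts a common divisor of those rows into position
  \<open>(1, 0)\<close>. An operation on the first two rows then produces a corner entry that divides this common
  divisor and the (transformed) first row, hence everything.
\<close>

lemma gcd_pivot_stack:
  assumes two: "gcd_pivot 2 n" and m: "gcd_pivot m n" and pos: "0 < m" "0 < n"
  shows "gcd_pivot (Suc m) n"
  unfolding gcd_pivot_def
proof
  fix A assume A: "A \<in> mats R (Suc m) n"
  let ?A0 = "row_block 0 1 A" and ?A1 = "row_block 1 m A"
  have A0: "?A0 \<in> mats R 1 n" and A1: "?A1 \<in> mats R m n"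
    using row_block_closed[OF A] by simp_all
  obtain P1 Q1 where PQ1: "P1 \<in> GL m" "Q1 \<in> GL n"
    and e: "divides_mat ((P1 \<odot> ?A1 \<odot> Q1) $$ (0, 0)) ?A1"
    using m A1 unfolding gcd_pivot_def by blast
  note P1 = GL_mats[OF PQ1(1)] and Q1 = GL_mats[OF PQ1(2)]
  define T where "T = dsum (mat_one R 1) P1"
  have T_GL: "T \<in> GL (Suc m)" using GL_dsum[OF GL_one[of 1] PQ1(1)] by (simp add: T_def)
  note T = GL_mats[OF T_GL]
  define A' where "A' = T \<odot> A \<odot> Q1"
  have TA: "T \<odot> A \<in> mats R (Suc m) n" by (rule mat_times_closed[OF T A])
  have A': "A' \<in> mats R (Suc m) n" unfolding A'_def by (rule mat_times_closed[OF TA Q1])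
  have A'0: "row_block 0 1 A' = ?A0 \<odot> Q1" and A'1: "row_block 1 m A' = P1 \<odot> ?A1 \<odot> Q1"
    using A row_block_times[OF TA Q1] row_block_dsum_times[OF mat_one_closed[of 1] P1, of A n]
      mat_times_one_left[OF A0]
    unfolding A'_def T_def by simp_all
  let ?B = "row_block 0 2 A'"
  have B: "?B \<in> mats R 2 n" using row_block_closed[OF A'] pos by simp
  obtain P2 Q2 where PQ2: "P2 \<in> GL 2" "Q2 \<in> GL n"
    and f_dvd: "divides_mat ((P2 \<odot> ?B \<odot> Q2) $$ (0, 0)) ?B"
    using two B unfolding gcd_pivot_def by blast
  note P2 = GL_mats[OF PQ2(1)] and Q2 = GL_mats[OF PQ2(2)]
  define f where "f = (P2 \<odot> ?B \<odot> Q2) $$ (0, 0)"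
  have f: "f \<in> carrier R"
    unfolding f_def using mats_entry[OF mat_times_closed[OF mat_times_closed[OF P2 B] Q2]] pos by simp
  define U where "U = dsum P2 (mat_one R (m - 1))"
  have U_GL: "U \<in> GL (Suc m)" using GL_dsum[OF PQ2(1) GL_one[of "m - 1"]] pos by (simp add: U_def)
  note U = GL_mats[OF U_GL]
  have UA': "U \<odot> A' \<in> mats R (Suc m) n" by (rule mat_times_closed[OF U A'])
  have "row_block 0 2 (U \<odot> A' \<odot> Q2) = P2 \<odot> ?B \<odot> Q2"
    using row_block_times[OF UA' Q2, of 0 2] A' pos
      row_block_dsum_times(1)[OF P2 mat_one_closed[of "m - 1"], of A' n]
    unfolding U_def by simp
  then have "(U \<odot> A' \<odot> Q2) $$ (0, 0) = f"
    unfolding f_def using mats_dim[OF Q2] pos row_block_00[of 2 "U \<odot> A' \<odot> Q2"] by simp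
  moreover have "U \<odot> A' \<odot> Q2 = (U \<odot> T) \<odot> A \<odot> (Q1 \<odot> Q2)"
    unfolding A'_def by (rule mat_times_regroup[OF U T A Q1 Q2])
  ultimately have f_eq: "((U \<odot> T) \<odot> A \<odot> (Q1 \<odot> Q2)) $$ (0, 0) = f" by simp
  have f_B: "f divides A' $$ (i, j)" if "i < 2" "j < n" for i j
    using f_dvd that A' unfolding f_def[symmetric] divides_mat_def
    by (auto simp: row_block_def mats_iff)
  have "divides_mat f (row_block 0 1 A')"
    using f_B A' by (auto simp: divides_mat_def row_block_def mats_iff)
  then have f0: "divides_mat f ?A0"
    unfolding A'0 using divides_mat_GL_right[OF PQ1(2) A0 f] by simp
  have "(P1 \<odot> ?A1 \<odot> Q1) $$ (0, 0) = A' $$ (1, 0)"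
    unfolding A'1[symmetric] using A' pos by (simp add: row_block_def mats_iff)
  then have "f divides (P1 \<odot> ?A1 \<odot> Q1) $$ (0, 0)" using f_B[of 1 0] pos by simp
  then have f1: "divides_mat f ?A1"
    using e f unfolding divides_mat_def by (meson divides_trans)
  have "divides_mat f A"
    unfolding divides_mat_def
  proof (intro allI impI)
    fix i j assume ij: "i < dim_row A" "j < dim_col A"
    then show "f divides A $$ (i, j)"
      using f0 f1 A by (cases i) (auto simp: divides_mat_def row_block_def mats_iff)
  qed
  then show "\<exists>P\<in>GL (Suc m). \<exists>Q\<in>GL n. divides_mat ((P \<odot> A \<odot> Q) $$ (0, 0)) A"
    using GL_times[OF U_GL T_GL] GL_times[OF PQ1(2) PQ2(2)] f_eq by metis
qed

lemma gcd_pivot_1_1: "gcd_pivot 1 1"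
  unfolding gcd_pivot_def
proof
  fix A assume A: "A \<in> mats R 1 1"
  have "divides_mat (A $$ (0, 0)) A"
    using A mats_entry[OF A] by (auto simp: divides_mat_def mats_iff intro: divides_refl)
  then show "\<exists>P\<in>GL 1. \<exists>Q\<in>GL 1. divides_mat ((P \<odot> A \<odot> Q) $$ (0, 0)) A"
    using GL_one[of 1] mat_times_one_left[OF A] mat_times_one_right[OF A] by metis
qed

text \<open>
  Stacking rows reaches all sizes \<open>m\<close> by 1 and \<open>m\<close> by 2. By transposition this provides the sizes
  1 by \<open>n\<close> and 2 by \<open>n\<close>, from which stacking starts again.
\<close>

lemma gcd_pivot_all:
  assumes "gcd_pivot 2 1" "gcd_pivot 2 2" "0 < m" "0 < n"
  shows "gcd_pivot m n"
proof -
  have col: "gcd_pivot m 1" if "0 < m" for m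
    using that
  proof (induction m rule: nat_induct_non_zero)
    case 1 show ?case by (rule gcd_pivot_1_1)
  next
    case (Suc m) then show ?case using gcd_pivot_stack[OF assms(1), of m] by simp
  qed
  have two: "gcd_pivot m 2" if "0 < m" for m
    using that
  proof (induction m rule: nat_induct_non_zero)
    case 1 show ?case using gcd_pivot_transpose[OF assms(1)] by simp
  next
    case (Suc m) then show ?case using gcd_pivot_stack[OF assms(2), of m] by simp
  qed
  show ?thesis
    using assms(3)
  proof (induction m rule: nat_induct_non_zero)
    case 1 show ?case using gcd_pivot_transpose[OF col] assms(4) by simp
  next
    case (Suc m)
    then show ?case
      using gcd_pivot_stack[OF gcd_pivot_transpose[OF two], of n m] assms(4) by simp
  qed
qed

section \<open>Diagonal reduction\<close>

definition smith_form where
  "smith_form D \<longleftrightarrow>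
    (\<forall>i<dim_row D. \<forall>j<dim_col D. i \<noteq> j \<longrightarrow> D $$ (i, j) = \<zero>) \<and>
    (\<forall>i. Suc i < min (dim_row D) (dim_col D) \<longrightarrow> D $$ (i, i) divides D $$ (Suc i, Suc i))"

lemma admits_diagonal_reduction_iff:
  assumes "A \<in> mats R m n"
  shows "admits_diagonal_reduction R A \<longleftrightarrow> (\<exists>P\<in>GL m. \<exists>Q\<in>GL n. smith_form (P \<odot> A \<odot> Q))"
proof -
  have "dim_row (P \<odot> A \<odot> Q) = m \<and> dim_col (P \<odot> A \<odot> Q) = n" if "P \<in> GL m" "Q \<in> GL n" for P Q
    using GL_mats[OF that(1)] GL_mats[OF that(2)] by (simp add: mats_iff)
  then show ?thesis
    unfolding admits_diagonal_reduction_def smith_form_def Let_def mats_dim[OF assms]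
    by (intro bex_cong refl) simp
qed

lemma admits_diagonal_reduction_equiv:
  assumes A: "A \<in> mats R m n" and P: "P \<in> GL m" and Q: "Q \<in> GL n"
    and red: "admits_diagonal_reduction R (P \<odot> A \<odot> Q)"
  shows "admits_diagonal_reduction R A"
proof -
  note P' = GL_mats[OF P] and Q' = GL_mats[OF Q]
  have PAQ: "P \<odot> A \<odot> Q \<in> mats R m n" using A P' Q' by (intro mat_times_closed)
  then obtain U V where UV: "U \<in> GL m" "V \<in> GL n" "smith_form (U \<odot> (P \<odot> A \<odot> Q) \<odot> V)"
    using red admits_diagonal_reduction_iff by blast
  have "U \<odot> (P \<odot> A \<odot> Q) \<odot> V = (U \<odot> P) \<odot> A \<odot> (Q \<odot> V)"
    by (rule mat_times_regroup[OF GL_mats[OF UV(1)] P' A Q' GL_mats[OF UV(2)]])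
  then show ?thesis
    using UV GL_times P Q admits_diagonal_reduction_iff[OF A] by metis
qed

lemma clear_first_column:
  assumes A: "A \<in> mats R (Suc m) n" and "0 < n" and dvd: "divides_mat (A $$ (0, 0)) A"
  obtains P where "P \<in> GL (Suc m)" "\<And>j. j < n \<Longrightarrow> (P \<odot> A) $$ (0, j) = A $$ (0, j)"
    "\<And>i. 0 < i \<Longrightarrow> i < Suc m \<Longrightarrow> (P \<odot> A) $$ (i, 0) = \<zero>"
proof -
  have "\<forall>i\<in>{1..<Suc m}. \<exists>c\<in>carrier R. A $$ (i, 0) = A $$ (0, 0) \<otimes> c"
    using dvd assms(2) A by (auto simp: divides_mat_def factor_def mats_iff)
  then obtain c where c: "\<And>i. i \<in> {1..<Suc m} \<Longrightarrow> c i \<in> carrier R"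
    "\<And>i. i \<in> {1..<Suc m} \<Longrightarrow> A $$ (i, 0) = A $$ (0, 0) \<otimes> c i"
    by metis
  have c': "(\<lambda>i. \<ominus> c i) \<in> {1..<Suc m} \<rightarrow> carrier R" using c by auto
  note ix = shear_times_index[OF A c']
  show thesis
  proof (rule that[OF shear_GL[OF c']])
    show "(shear (Suc m) (\<lambda>i. \<ominus> c i) \<odot> A) $$ (0, j) = A $$ (0, j)" if "j < n" for j
      using ix[of 0 j] that by simp
    show "(shear (Suc m) (\<lambda>i. \<ominus> c i) \<odot> A) $$ (i, 0) = \<zero>" if "0 < i" "i < Suc m" for i
    proof -
      have "A $$ (0, 0) \<in> carrier R" "c i \<in> carrier R" "A $$ (i, 0) = c i \<otimes> A $$ (0, 0)"
        using mats_entry[OF A] assms(2) c[of i] that by (simp_all add: m_comm)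
      then show ?thesis using ix[of i 0] that assms(2) by (simp add: l_minus r_neg)
    qed
  qed
qed

text \<open>
  Column operations are row operations on the transpose. Clearing the first row does not disturb
  the cleared first column, because multiples of column 0 are added to the other columns only.
\<close>

lemma split_off_pivot:
  assumes A: "A \<in> mats R (Suc m) (Suc n)" and dvd: "divides_mat (A $$ (0, 0)) A"
  obtains P Q B where "P \<in> GL (Suc m)" "Q \<in> GL (Suc n)" "B \<in> mats R m n"
    "divides_mat (A $$ (0, 0)) B" "P \<odot> A \<odot> Q = dsum (mat 1 1 (\<lambda>_. A $$ (0, 0))) B"
proof -
  define d where "d = A $$ (0, 0)"
  have d: "d \<in> carrier R" using mats_entry[OF A] by (simp add: d_def)
  obtain P where P: "P \<in> GL (Suc m)" "\<And>j. j < Suc n \<Longrightarrow> (P \<odot> A) $$ (0, j) = A $$ (0, j)"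
    "\<And>i. 0 < i \<Longrightarrow> i < Suc m \<Longrightarrow> (P \<odot> A) $$ (i, 0) = \<zero>"
    using clear_first_column[OF A _ dvd] by auto
  define C where "C = P \<odot> A"
  have C: "C \<in> mats R (Suc m) (Suc n)" unfolding C_def by (rule mat_times_closed[OF GL_mats[OF P(1)] A])
  have C00: "C $$ (0, 0) = d" using P(2)[of 0] by (simp add: C_def d_def)
  have C_dvd: "divides_mat d C"
    using dvd divides_mat_GL_left[OF P(1) A d] by (simp add: C_def d_def)
  note CT = transpose_mats[OF C]
  have CT00: "transpose_mat C $$ (0, 0) = d" using C00 mats_dim[OF C] by simp
  obtain U where U: "U \<in> GL (Suc n)"
    "\<And>j. j < Suc m \<Longrightarrow> (U \<odot> transpose_mat C) $$ (0, j) = transpose_mat C $$ (0, j)"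
    "\<And>i. 0 < i \<Longrightarrow> i < Suc n \<Longrightarrow> (U \<odot> transpose_mat C) $$ (i, 0) = \<zero>"
    using clear_first_column[OF CT] C_dvd unfolding CT00 by (auto simp: divides_mat_transpose)
  define Q where "Q = transpose_mat U"
  have Q: "Q \<in> GL (Suc n)" unfolding Q_def by (rule GL_transpose[OF U(1)])
  define E where "E = C \<odot> Q"
  have E: "E \<in> mats R (Suc m) (Suc n)" unfolding E_def by (rule mat_times_closed[OF C GL_mats[OF Q]])
  have "U \<odot> transpose_mat C = transpose_mat E"
    unfolding E_def Q_def using transpose_mat_times[OF C transpose_mats[OF GL_mats[OF U(1)]]] by simp
  then have UE: "(U \<odot> transpose_mat C) $$ (j, i) = E $$ (i, j)" if "i < Suc m" "j < Suc n" for i j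
    using that mats_dim[OF E] by simp
  have E_col: "E $$ (i, 0) = (if i = 0 then d else \<zero>)" if "i < Suc m" for i
    using U(2)[OF that] UE[OF that, of 0] P(3)[of i] that mats_dim[OF C] C00 by (auto simp: C_def)
  have E_row: "E $$ (0, j) = (if j = 0 then d else \<zero>)" if "j < Suc n" for j
    using U(3)[of j] UE[of 0 j] that E_col[of 0] by auto
  have E_dvd: "divides_mat d E"
    using C_dvd divides_mat_GL_right[OF Q C d] by (simp add: E_def)
  define B where "B = mat m n (\<lambda>(i, j). E $$ (Suc i, Suc j))"
  have B: "B \<in> mats R m n" using mats_entry[OF E] by (auto simp: mats_iff B_def)
  have B_dvd: "divides_mat d B" using E_dvd mats_dim[OF E] by (auto simp: divides_mat_def B_def)
  have "E = dsum (mat 1 1 (\<lambda>_. d)) B"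
  proof (rule eq_matI)
    fix i j assume "i < dim_row (dsum (mat 1 1 (\<lambda>_. d)) B)" "j < dim_col (dsum (mat 1 1 (\<lambda>_. d)) B)"
    then show "E $$ (i, j) = dsum (mat 1 1 (\<lambda>_. d)) B $$ (i, j)"
      using E_col E_row by (cases i; cases j) (auto simp: dsum_def B_def)
  qed (use mats_dim[OF E] in \<open>simp_all add: B_def\<close>)
  then show thesis
    using that[OF P(1) Q B] B_dvd by (simp add: E_def C_def d_def)
qed

text \<open>
  Induction on the number of rows. The divisibility chain survives because the pivot divides the
  remaining block and therefore every matrix equivalent to that block.
\<close>

lemma diagonal_reduction_of_gcd_pivot:
  assumes pivot: "\<And>m n. 0 < m \<Longrightarrow> 0 < n \<Longrightarrow> gcd_pivot m n"
  shows "A \<in> mats R m n \<Longrightarrow> admits_diagonal_reduction R A"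
proof (induction m arbitrary: n A)
  case 0
  then have "smith_form (mat_one R 0 \<odot> A \<odot> mat_one R n)"
    by (auto simp: smith_form_def mats_iff)
  then show ?case using admits_diagonal_reduction_iff[OF 0] GL_one by blast
next
  case (Suc m)
  note A = Suc.prems
  show ?case
  proof (cases n)
    case 0
    then have "smith_form (mat_one R (Suc m) \<odot> A \<odot> mat_one R n)"
      by (auto simp: smith_form_def mats_iff)
    then show ?thesis using admits_diagonal_reduction_iff[OF A] GL_one by blast
  next
    case n: (Suc n')
    obtain P Q where PQ: "P \<in> GL (Suc m)" "Q \<in> GL n" "divides_mat ((P \<odot> A \<odot> Q) $$ (0, 0)) A"
      using pivot[of "Suc m" n] A n unfolding gcd_pivot_def by blast
    define M where "M = P \<odot> A \<odot> Q"
    have PA: "P \<odot> A \<in> mats R (Suc m) n" by (rule mat_times_closed[OF GL_mats[OF PQ(1)] A])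
    have M: "M \<in> mats R (Suc m) (Suc n')"
      unfolding M_def using mat_times_closed[OF PA GL_mats[OF PQ(2)]] n by simp
    define d where "d = M $$ (0, 0)"
    have d: "d \<in> carrier R" using mats_entry[OF M] by (simp add: d_def)
    have "divides_mat d M"
      using PQ(3) divides_mat_GL_left[OF PQ(1) A d] divides_mat_GL_right[OF PQ(2) PA d]
      by (simp add: M_def d_def)
    then obtain U V B where UV: "U \<in> GL (Suc m)" "V \<in> GL (Suc n')" and B: "B \<in> mats R m n'"
      and B_dvd: "divides_mat d B" and UMV: "U \<odot> M \<odot> V = dsum (mat 1 1 (\<lambda>_. d)) B"
      using split_off_pivot[OF M] unfolding d_def by metis
    obtain X Y where XY: "X \<in> GL m" "Y \<in> GL n'" "smith_form (X \<odot> B \<odot> Y)"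
      using Suc.IH[OF B] admits_diagonal_reduction_iff[OF B] by blast
    note X = GL_mats[OF XY(1)] and Y = GL_mats[OF XY(2)]
    have XB: "X \<odot> B \<in> mats R m n'" by (rule mat_times_closed[OF X B])
    have XBY: "X \<odot> B \<odot> Y \<in> mats R m n'" by (rule mat_times_closed[OF XB Y])
    have dm: "mat 1 1 (\<lambda>_. d) \<in> mats R 1 1" using d by (simp add: mats_iff)
    have "dsum (mat_one R 1) X \<odot> dsum (mat 1 1 (\<lambda>_. d)) B \<odot> dsum (mat_one R 1) Y
        = dsum (mat 1 1 (\<lambda>_. d)) (X \<odot> B \<odot> Y)"
      using dsum_times_dsum[OF mat_one_closed X dm B] dsum_times_dsum[OF dm XB mat_one_closed Y]
        mat_times_one_left[OF dm] mat_times_one_right[OF dm] by simp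
    moreover have "smith_form (dsum (mat 1 1 (\<lambda>_. d)) (X \<odot> B \<odot> Y))"
    proof -
      have dv: "divides_mat d (X \<odot> B \<odot> Y)"
        using B_dvd divides_mat_times_left[OF d X B] divides_mat_times_right[OF d XB Y] by blast
      show ?thesis
        unfolding smith_form_def
      proof (intro conjI allI impI)
        fix i j assume "i < dim_row (dsum (mat 1 1 (\<lambda>_. d)) (X \<odot> B \<odot> Y))"
          "j < dim_col (dsum (mat 1 1 (\<lambda>_. d)) (X \<odot> B \<odot> Y))" "i \<noteq> j"
        then show "dsum (mat 1 1 (\<lambda>_. d)) (X \<odot> B \<odot> Y) $$ (i, j) = \<zero>"
          using XY(3) by (cases i; cases j) (auto simp: dsum_def smith_form_def)
      next
        fix i assume "Suc i < min (dim_row (dsum (mat 1 1 (\<lambda>_. d)) (X \<odot> B \<odot> Y)))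
          (dim_col (dsum (mat 1 1 (\<lambda>_. d)) (X \<odot> B \<odot> Y)))"
        then show "dsum (mat 1 1 (\<lambda>_. d)) (X \<odot> B \<odot> Y) $$ (i, i) divides
          dsum (mat 1 1 (\<lambda>_. d)) (X \<odot> B \<odot> Y) $$ (Suc i, Suc i)"
          using XY(3) dv by (cases i) (auto simp: dsum_def smith_form_def divides_mat_def)
      qed
    qed
    moreover have "dsum (mat_one R 1) X \<in> GL (Suc m)" "dsum (mat_one R 1) Y \<in> GL (Suc n')"
      using GL_dsum[OF GL_one[of 1] XY(1)] GL_dsum[OF GL_one[of 1] XY(2)] by simp_all
    moreover have "dsum (mat 1 1 (\<lambda>_. d)) B \<in> mats R (Suc m) (Suc n')"
      using dsum_closed[OF dm B] by simp
    ultimately have "admits_diagonal_reduction R (U \<odot> M \<odot> V)"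
      unfolding UMV using admits_diagonal_reduction_iff by metis
    then have "admits_diagonal_reduction R M"
      by (rule admits_diagonal_reduction_equiv[OF M UV])
    then show ?thesis
      unfolding M_def by (rule admits_diagonal_reduction_equiv[OF A PQ(1,2)])
  qed
qed

section \<open>Elementary divisor rings are Bezout\<close>

lemma principal_insert:
  assumes S: "S \<subseteq> carrier R" and e: "e \<in> carrier R" "Idl S = PIdl e"
    and a: "a \<in> carrier R" and xy: "x \<in> carrier R" "y \<in> carrier R"
    and d: "d = a \<otimes> x \<oplus> e \<otimes> y" "d divides a" "d divides e"
  shows "Idl (insert a S) = PIdl d"
proof
  have dc: "d \<in> carrier R" using d(1) a e xy by simp
  have dvd_mem: "b \<in> PIdl d" if "d divides b" for b
    using that dc unfolding factor_def cgenideal_def by (blast intro: m_comm)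
  have aS: "insert a S \<subseteq> carrier R" using S a by simp
  have "a \<in> PIdl d" by (rule dvd_mem[OF d(2)])
  moreover have "PIdl e \<subseteq> PIdl d"
    by (rule cgenideal_minimal[OF cgenideal_ideal[OF dc] dvd_mem[OF d(3)]])
  then have "S \<subseteq> PIdl d" using genideal_self[OF S] e(2) by simp
  ultimately show "Idl (insert a S) \<subseteq> PIdl d"
    by (intro genideal_minimal cgenideal_ideal dc) simp
  interpret I: ideal "Idl (insert a S)" R by (rule genideal_ideal[OF aS])
  have "e \<in> Idl S" using e cgenideal_self by simp
  moreover have "Idl S \<subseteq> Idl (insert a S)"
    using genideal_self[OF aS] by (intro genideal_minimal I.is_ideal) simp
  ultimately have "e \<in> Idl (insert a S)" by blast
  moreover have "a \<in> Idl (insert a S)" using genideal_self[OF aS] by simp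
  ultimately have "d \<in> Idl (insert a S)"
    unfolding d(1) using xy by (intro I.a_closed I.I_r_closed)
  then show "PIdl d \<subseteq> Idl (insert a S)" by (rule cgenideal_minimal[OF I.is_ideal])
qed

lemma bezout_ring_of_pairs:
  assumes pairs: "\<And>a b. a \<in> carrier R \<Longrightarrow> b \<in> carrier R \<Longrightarrow>
    \<exists>x\<in>carrier R. \<exists>y\<in>carrier R. (a \<otimes> x \<oplus> b \<otimes> y) divides a \<and> (a \<otimes> x \<oplus> b \<otimes> y) divides b"
  shows "bezout_ring R"
proof -
  have "\<exists>d\<in>carrier R. Idl S = PIdl d" if "finite S" "S \<subseteq> carrier R" for S
    using that
  proof (induction S rule: finite_induct)
    case empty
    have "Idl {} = Idl {\<zero>}"
    proof
      show "Idl {} \<subseteq> Idl {\<zero>}" by (intro genideal_minimal genideal_ideal) simp_all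
      have I: "ideal (Idl {}) R" by (rule genideal_ideal) simp
      show "Idl {\<zero>} \<subseteq> Idl {}"
        using additive_subgroup.zero_closed[OF ideal.axioms(1)[OF I]]
        by (intro genideal_minimal I) simp
    qed
    then show ?case using cgenideal_eq_genideal[OF zero_closed] zero_closed by metis
  next
    case (insert a S)
    then obtain e where e: "e \<in> carrier R" "Idl S = PIdl e" by auto
    have a: "a \<in> carrier R" and S: "S \<subseteq> carrier R" using insert.prems by auto
    obtain x y where xy: "x \<in> carrier R" "y \<in> carrier R"
      "(a \<otimes> x \<oplus> e \<otimes> y) divides a" "(a \<otimes> x \<oplus> e \<otimes> y) divides e"
      using pairs[OF a e(1)] by blast
    have "a \<otimes> x \<oplus> e \<otimes> y \<in> carrier R" using a e xy by simp
    then show ?case using principal_insert[OF S e a xy(1,2) refl xy(3,4)] by blast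
  qed
  then show ?thesis
    unfolding bezout_ring_def
    using cgenideal_is_principalideal by metis
qed

text \<open>
  For the 1 by 2 matrix \<open>(a, b)\<close> a diagonal form is \<open>(d, \<zero>)\<close>. Invertible factors do not change the
  common divisors of the entries, so \<open>d\<close> divides \<open>a\<close> and \<open>b\<close>; and \<open>d\<close> is a combination of them.
\<close>

lemma elementary_divisor_ring_imp_bezout_ring:
  assumes "elementary_divisor_ring R"
  shows "bezout_ring R"
proof (rule bezout_ring_of_pairs)
  fix a b assume ab: "a \<in> carrier R" "b \<in> carrier R"
  define A where "A = mat 1 2 (\<lambda>(i, j). if j = 0 then a else b)"
  have A: "A \<in> mats R 1 2" using ab by (auto simp: mats_iff A_def)
  have A_index: "A $$ (0, 0) = a" "A $$ (0, Suc 0) = b" by (simp_all add: A_def)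
  obtain P Q where PQ: "P \<in> GL 1" "Q \<in> GL 2" "smith_form (P \<odot> A \<odot> Q)"
    using assms A admits_diagonal_reduction_iff[OF A] unfolding elementary_divisor_ring_def by blast
  note P = GL_mats[OF PQ(1)] and Q = GL_mats[OF PQ(2)]
  have PA: "P \<odot> A \<in> mats R 1 2" by (rule mat_times_closed[OF P A])
  have PAQ: "P \<odot> A \<odot> Q \<in> mats R 1 2" by (rule mat_times_closed[OF PA Q])
  define d where "d = (P \<odot> A \<odot> Q) $$ (0, 0)"
  define p where "p = P $$ (0, 0)"
  have p: "p \<in> carrier R" using mats_entry[OF P] by (simp add: p_def)
  have d: "d \<in> carrier R" using mats_entry[OF PAQ] by (simp add: d_def)
  have q: "Q $$ (0, 0) \<in> carrier R" "Q $$ (1, 0) \<in> carrier R" using mats_entry[OF Q] by simp_all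
  have PA_index: "(P \<odot> A) $$ (0, j) = p \<otimes> A $$ (0, j)" if "j < 2" for j
    using that P A p mats_entry[OF A]
    by (simp add: mat_times_index mats_iff finsum_lessThan_1 p_def)
  have "d = (P \<odot> A) $$ (0, 0) \<otimes> Q $$ (0, 0) \<oplus> (P \<odot> A) $$ (0, 1) \<otimes> Q $$ (1, 0)"
    unfolding d_def using mats_dim[OF PA] mats_dim[OF Q] mats_entry[OF PA] q
    by (subst mat_times_index) (simp_all add: finsum_lessThan_2)
  also have "\<dots> = a \<otimes> (p \<otimes> Q $$ (0, 0)) \<oplus> b \<otimes> (p \<otimes> Q $$ (1, 0))"
    using ab p q by (simp add: PA_index A_index m_ac)
  finally have d_eq: "d = a \<otimes> (p \<otimes> Q $$ (0, 0)) \<oplus> b \<otimes> (p \<otimes> Q $$ (1, 0))" .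
  have "(P \<odot> A \<odot> Q) $$ (0, 1) = d \<otimes> \<zero>"
    using PQ(3) d mats_dim[OF PAQ] by (simp add: smith_form_def)
  moreover have "(P \<odot> A \<odot> Q) $$ (0, 0) = d \<otimes> \<one>" using d by (simp add: d_def)
  ultimately have "divides_mat d (P \<odot> A \<odot> Q)"
    using mats_dim[OF PAQ] unfolding divides_mat_def factor_def
    by (auto simp: less_2_cases_iff)
  then have "divides_mat d A"
    using divides_mat_GL_right[OF PQ(2) PA d] divides_mat_GL_left[OF PQ(1) A d] by simp
  then have "d divides a" "d divides b"
    using mats_dim[OF A] A_index unfolding divides_mat_def by force+
  then show "\<exists>x\<in>carrier R. \<exists>y\<in>carrier R.
      (a \<otimes> x \<oplus> b \<otimes> y) divides a \<and> (a \<otimes> x \<oplus> b \<otimes> y) divides b"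
    using p q unfolding d_eq by blast
qed

end

section \<open>Bezout J-stable rings are Hermite\<close>

locale J_stable_ring = cring +
  assumes J_stable: "J_stable R"
begin

lemma stable_range_1_mod:
  assumes "c \<notin> jacobson_radical R"
    and "a \<in> carrier R" "b \<in> carrier R" "c \<in> carrier R"
      "x \<in> carrier R" "y \<in> carrier R" "z \<in> carrier R"
    and "a \<otimes> x \<oplus> b \<otimes> y \<oplus> c \<otimes> z = \<one>"
  obtains t u v where "t \<in> carrier R" "u \<in> carrier R" "v \<in> carrier R"
    "(a \<oplus> b \<otimes> t) \<otimes> u \<oplus> c \<otimes> v = \<one>"
  using stable_range_1_quotient_lift[of c a b x y z] assms J_stable that
  unfolding J_stable_def by blast

text \<open>
  If \<open>a\<close> or \<open>b\<close> lies outside the radical, only the other one has to be changed. If both lie in the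
  radical, \<open>c\<close> is a unit and a multiple of \<open>c\<close> turns \<open>a\<close> into \<open>\<one>\<close>.
\<close>

lemma stable_range_2:
  assumes car: "a \<in> carrier R" "b \<in> carrier R" "c \<in> carrier R"
      "x \<in> carrier R" "y \<in> carrier R" "z \<in> carrier R"
    and sum: "a \<otimes> x \<oplus> b \<otimes> y \<oplus> c \<otimes> z = \<one>"
  obtains u v s t where "u \<in> carrier R" "v \<in> carrier R" "s \<in> carrier R" "t \<in> carrier R"
    "(a \<oplus> c \<otimes> u) \<otimes> s \<oplus> (b \<oplus> c \<otimes> v) \<otimes> t = \<one>"
proof -
  consider "a \<notin> jacobson_radical R" | "b \<notin> jacobson_radical R"
    | "a \<in> jacobson_radical R" "b \<in> jacobson_radical R" by blast
  then show thesis
  proof cases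
    case 1
    have "b \<otimes> y \<oplus> c \<otimes> z \<oplus> a \<otimes> x = \<one>" using sum car by (simp add: a_ac)
    then obtain v t s where "v \<in> carrier R" "t \<in> carrier R" "s \<in> carrier R"
      "(b \<oplus> c \<otimes> v) \<otimes> t \<oplus> a \<otimes> s = \<one>"
      using stable_range_1_mod[OF 1] car by metis
    then show thesis using that[of \<zero> v s t] car by (simp add: a_comm)
  next
    case 2
    have "a \<otimes> x \<oplus> c \<otimes> z \<oplus> b \<otimes> y = \<one>" using sum car by (simp add: a_ac)
    then obtain u s t where "u \<in> carrier R" "s \<in> carrier R" "t \<in> carrier R"
      "(a \<oplus> c \<otimes> u) \<otimes> s \<oplus> b \<otimes> t = \<one>"
      using stable_range_1_mod[OF 2] car by metis
    then show thesis using that[of u \<zero> s t] car by simp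
  next
    case 3
    have "a \<otimes> x \<oplus> c \<otimes> z \<oplus> b \<otimes> y = \<one>" using sum car by (simp add: a_ac)
    then obtain w where w: "w \<in> carrier R" "c \<otimes> w = \<one>"
      using unit_of_jacobson_sum[OF 3] car by metis
    have "c \<otimes> (w \<otimes> (\<one> \<ominus> a)) = \<one> \<ominus> a" using w car by (simp flip: m_assoc)
    then have "a \<oplus> c \<otimes> (w \<otimes> (\<one> \<ominus> a)) = a \<oplus> (\<one> \<ominus> a)" by simp
    also have "\<dots> = \<one>" using car by (simp add: cring_normalize)
    finally show thesis using that[of "w \<otimes> (\<one> \<ominus> a)" \<zero> \<one> \<zero>] w car by simp
  qed
qed

text \<open>
  The matrix is the lower triangular one with rows \<open>(a, \<zero>)\<close> and \<open>(b, c)\<close>. Modulo \<open>c\<close>, adding a multiple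
  of the first row to the second makes \<open>b\<close> a unit; modulo \<open>a\<close>, adding a multiple of the second column
  to the first does. If neither quotient is available, \<open>b\<close> itself is a unit.
\<close>

lemma unimodular_triangular_represents_one:
  assumes car: "a \<in> carrier R" "b \<in> carrier R" "c \<in> carrier R"
      "x \<in> carrier R" "y \<in> carrier R" "z \<in> carrier R"
    and sum: "a \<otimes> x \<oplus> b \<otimes> y \<oplus> c \<otimes> z = \<one>"
  obtains p q r s where "p \<in> carrier R" "q \<in> carrier R" "r \<in> carrier R" "s \<in> carrier R"
    "p \<otimes> (a \<otimes> r) \<oplus> q \<otimes> (b \<otimes> r \<oplus> c \<otimes> s) = \<one>"
proof -
  consider "c \<notin> jacobson_radical R" | "a \<notin> jacobson_radical R"
    | "a \<in> jacobson_radical R" "c \<in> jacobson_radical R" by blast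
  then show thesis
  proof cases
    case 1
    have "b \<otimes> y \<oplus> a \<otimes> x \<oplus> c \<otimes> z = \<one>" using sum car by (simp add: a_ac)
    then obtain p r s where w: "p \<in> carrier R" "r \<in> carrier R" "s \<in> carrier R"
      "(b \<oplus> a \<otimes> p) \<otimes> r \<oplus> c \<otimes> s = \<one>"
      using stable_range_1_mod[OF 1] car by metis
    have "p \<otimes> (a \<otimes> r) \<oplus> \<one> \<otimes> (b \<otimes> r \<oplus> c \<otimes> s) = (b \<oplus> a \<otimes> p) \<otimes> r \<oplus> c \<otimes> s"
      using w(1-3) car by (simp add: cring_normalize)
    then show thesis using that[of p \<one> r s] w by simp
  next
    case 2
    have "b \<otimes> y \<oplus> c \<otimes> z \<oplus> a \<otimes> x = \<one>" using sum car by (simp add: a_ac)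
    then obtain s q p where w: "s \<in> carrier R" "q \<in> carrier R" "p \<in> carrier R"
      "(b \<oplus> c \<otimes> s) \<otimes> q \<oplus> a \<otimes> p = \<one>"
      using stable_range_1_mod[OF 2] car by metis
    have "p \<otimes> (a \<otimes> \<one>) \<oplus> q \<otimes> (b \<otimes> \<one> \<oplus> c \<otimes> s) = (b \<oplus> c \<otimes> s) \<otimes> q \<oplus> a \<otimes> p"
      using w(1-3) car by (simp add: cring_normalize)
    then show thesis using that[of p q \<one> s] w by simp
  next
    case 3
    then obtain r where "r \<in> carrier R" "b \<otimes> r = \<one>"
      using unit_of_jacobson_sum[OF 3] sum car by metis
    then show thesis using that[of \<zero> \<one> r \<zero>] car by simp
  qed
qed

end

locale bezout_J_stable_ring = J_stable_ring +
  assumes bezout: "bezout_ring R"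
begin

lemma bezout_pair:
  assumes "a \<in> carrier R" "b \<in> carrier R"
  obtains d x y where "d \<in> carrier R" "x \<in> carrier R" "y \<in> carrier R"
    "d = a \<otimes> x \<oplus> b \<otimes> y" "d divides a" "d divides b"
proof -
  have S: "{a, b} \<subseteq> carrier R" using assms by auto
  then have "principalideal (Idl {a, b}) R" using bezout unfolding bezout_ring_def by auto
  then obtain d where d: "d \<in> carrier R" "Idl {a, b} = PIdl d"
    by (metis principalideal.generate cgenideal_eq_genideal)
  have "d divides a" "d divides b"
    using genideal_self[OF S] d assms by (auto simp: cgenideal_def factor_def m_comm)
  moreover have "Idl {a, b} \<subseteq> PIdl a <+> PIdl b"
  proof (rule genideal_minimal)
    show "ideal (PIdl a <+> PIdl b) R" using assms by (intro add_ideals cgenideal_ideal)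
    have "a \<oplus> \<zero> \<in> PIdl a <+> PIdl b" "\<zero> \<oplus> b \<in> PIdl a <+> PIdl b"
      unfolding set_add_def'
      using cgenideal_self assms additive_subgroup.zero_closed[OF ideal.axioms(1)[OF cgenideal_ideal]]
      by blast+
    then show "{a, b} \<subseteq> PIdl a <+> PIdl b" using assms by simp
  qed
  then have "d \<in> PIdl a <+> PIdl b" using d cgenideal_self by blast
  then obtain x y where "x \<in> carrier R" "y \<in> carrier R" "d = x \<otimes> a \<oplus> y \<otimes> b"
    unfolding set_add_def' cgenideal_def by auto
  ultimately show thesis using that[of d x y] d assms by (simp add: m_comm)
qed

text \<open>
  The gcd \<open>d\<close> is annihilated by \<open>\<one> - (a' x + b' y)\<close>, so a cofactor may be changed by multiples of this
  element.
\<close>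

lemma hermite_correction:
  assumes c: "a \<in> carrier R" "b \<in> carrier R" "d \<in> carrier R" "a' \<in> carrier R" "b' \<in> carrier R"
    "x \<in> carrier R" "y \<in> carrier R" "u \<in> carrier R"
    and a: "a = d \<otimes> a'" and b: "b = d \<otimes> b'" and d: "d = a \<otimes> x \<oplus> b \<otimes> y"
  shows "d \<otimes> (a' \<oplus> (\<one> \<ominus> (a' \<otimes> x \<oplus> b' \<otimes> y)) \<otimes> u) = a"
proof -
  have "d \<otimes> (a' \<oplus> (\<one> \<ominus> (a' \<otimes> x \<oplus> b' \<otimes> y)) \<otimes> u) = d \<otimes> a' \<oplus> (d \<ominus> (d \<otimes> a' \<otimes> x \<oplus> d \<otimes> b' \<otimes> y)) \<otimes> u"
    using c by (simp add: cring_normalize)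
  also have "d \<otimes> a' \<otimes> x \<oplus> d \<otimes> b' \<otimes> y = d" using a[symmetric] b[symmetric] d[symmetric] by simp
  also have "d \<otimes> a' \<oplus> (d \<ominus> d) \<otimes> u = d \<otimes> a'" using c by (simp add: cring_normalize)
  finally show ?thesis using a by simp
qed

text \<open>
  The annihilator element \<open>c = \<one> - (a' x + b' y)\<close> generates the unit ideal together with the
  cofactors \<open>a'\<close> and \<open>b'\<close>, so stable range 2 absorbs it into them.
\<close>

lemma hermite:
  assumes car: "a \<in> carrier R" "b \<in> carrier R"
  obtains d a' b' x y where "d \<in> carrier R" "a' \<in> carrier R" "b' \<in> carrier R"
    "x \<in> carrier R" "y \<in> carrier R" "a = d \<otimes> a'" "b = d \<otimes> b'" "a' \<otimes> x \<oplus> b' \<otimes> y = \<one>"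
proof -
  obtain d x y where d: "d \<in> carrier R" "x \<in> carrier R" "y \<in> carrier R"
    "d = a \<otimes> x \<oplus> b \<otimes> y" "d divides a" "d divides b" using bezout_pair car by metis
  obtain a' b' where ab: "a' \<in> carrier R" "b' \<in> carrier R"
    and eqs: "a = d \<otimes> a'" "b = d \<otimes> b'"
    using d(5,6) by (auto simp: factor_def)
  define c where "c = \<one> \<ominus> (a' \<otimes> x \<oplus> b' \<otimes> y)"
  have c: "c \<in> carrier R" using ab d(2,3) by (simp add: c_def)
  have "a' \<otimes> x \<oplus> b' \<otimes> y \<oplus> c \<otimes> \<one> = \<one>"
    unfolding c_def using ab d(2,3) by (simp add: cring_normalize)
  then obtain u v s t where w: "u \<in> carrier R" "v \<in> carrier R" "s \<in> carrier R" "t \<in> carrier R"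
    "(a' \<oplus> c \<otimes> u) \<otimes> s \<oplus> (b' \<oplus> c \<otimes> v) \<otimes> t = \<one>"
    using stable_range_2[OF ab c d(2,3) one_closed] by blast
  have "d \<otimes> (a' \<oplus> c \<otimes> u) = a"
    unfolding c_def by (rule hermite_correction[OF car d(1) ab d(2,3) w(1) eqs d(4)])
  moreover have "d \<otimes> (b' \<oplus> c \<otimes> v) = b"
  proof -
    have "c = \<one> \<ominus> (b' \<otimes> y \<oplus> a' \<otimes> x)" using ab d(2,3) by (simp add: c_def a_comm)
    moreover have "d = b \<otimes> y \<oplus> a \<otimes> x" unfolding d(4) using d(2,3) car by (simp add: a_comm)
    ultimately show ?thesis
      using hermite_correction[OF car(2,1) d(1) ab(2,1) d(3,2) w(2) eqs(2,1)] by simp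
  qed
  ultimately show thesis using that[OF d(1) _ _ w(3,4) _ _ w(5)] c ab w(1,2) by simp
qed

lemma hermite3:
  assumes car: "a \<in> carrier R" "b \<in> carrier R" "c \<in> carrier R"
  obtains g a' b' c' x y z where "g \<in> carrier R" "a' \<in> carrier R" "b' \<in> carrier R" "c' \<in> carrier R"
    "x \<in> carrier R" "y \<in> carrier R" "z \<in> carrier R"
    "a = g \<otimes> a'" "b = g \<otimes> b'" "c = g \<otimes> c'" "a' \<otimes> x \<oplus> b' \<otimes> y \<oplus> c' \<otimes> z = \<one>"
proof -
  obtain e a1 b1 s t where e: "e \<in> carrier R" "a1 \<in> carrier R" "b1 \<in> carrier R"
    "s \<in> carrier R" "t \<in> carrier R"
    and e_eqs: "a = e \<otimes> a1" "b = e \<otimes> b1" "a1 \<otimes> s \<oplus> b1 \<otimes> t = \<one>"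
    using hermite[OF car(1,2)] by metis
  obtain g e1 c1 p q where g: "g \<in> carrier R" "e1 \<in> carrier R" "c1 \<in> carrier R"
    "p \<in> carrier R" "q \<in> carrier R"
    and g_eqs: "e = g \<otimes> e1" "c = g \<otimes> c1" "e1 \<otimes> p \<oplus> c1 \<otimes> q = \<one>"
    using hermite[OF e(1) car(3)] by metis
  have "e1 \<otimes> a1 \<otimes> (s \<otimes> p) \<oplus> e1 \<otimes> b1 \<otimes> (t \<otimes> p) \<oplus> c1 \<otimes> q
      = (a1 \<otimes> s \<oplus> b1 \<otimes> t) \<otimes> (e1 \<otimes> p) \<oplus> c1 \<otimes> q"
    using e g by (simp add: cring_normalize)
  also have "\<dots> = \<one>" using e_eqs(3) g_eqs(3) g by simp
  finally have "e1 \<otimes> a1 \<otimes> (s \<otimes> p) \<oplus> e1 \<otimes> b1 \<otimes> (t \<otimes> p) \<oplus> c1 \<otimes> q = \<one>" .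
  moreover have "a = g \<otimes> (e1 \<otimes> a1)" "b = g \<otimes> (e1 \<otimes> b1)"
    unfolding e_eqs(1,2) g_eqs(1) using e g by (simp_all add: m_assoc)
  ultimately show thesis
    using that[of g "e1 \<otimes> a1" "e1 \<otimes> b1" c1 "s \<otimes> p" "t \<otimes> p" q] e g g_eqs(2) by simp
qed

section \<open>Reduction of small matrices\<close>

text \<open>
  A unimodular column operation makes the matrix lower triangular, with entries \<open>\<alpha>, \<beta>, \<gamma>\<close>. Their
  content \<open>g\<close> can be divided out, and the representation of \<open>\<one>\<close> by the quotient matrix is transported
  back to the original columns.
\<close>

lemma content_represented_2x2:
  assumes car: "a \<in> carrier R" "b \<in> carrier R" "c \<in> carrier R" "d \<in> carrier R"
  obtains p q r s g where "p \<in> carrier R" "q \<in> carrier R" "r \<in> carrier R" "s \<in> carrier R"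
    "g \<in> carrier R" "p \<otimes> (a \<otimes> r \<oplus> b \<otimes> s) \<oplus> q \<otimes> (c \<otimes> r \<oplus> d \<otimes> s) = g"
    "g divides a" "g divides b" "g divides c" "g divides d"
    "\<exists>x\<in>carrier R. \<exists>y\<in>carrier R. p \<otimes> x \<oplus> q \<otimes> y = \<one>"
    "\<exists>x\<in>carrier R. \<exists>y\<in>carrier R. x \<otimes> r \<oplus> y \<otimes> s = \<one>"
proof -
  obtain \<alpha> a1 b1 x y where e: "\<alpha> \<in> carrier R" "a1 \<in> carrier R" "b1 \<in> carrier R"
    "x \<in> carrier R" "y \<in> carrier R"
    and e_eqs: "a = \<alpha> \<otimes> a1" "b = \<alpha> \<otimes> b1" "a1 \<otimes> x \<oplus> b1 \<otimes> y = \<one>"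
    using hermite[OF car(1,2)] by metis
  \<comment> \<open>The column operation with columns \<open>(x, y)\<close> and \<open>(-b1, a1)\<close>, of determinant 1,
    takes \<open>(a, b)\<close> to \<open>(\<alpha>, 0)\<close> and \<open>(c, d)\<close> to \<open>(\<beta>, \<gamma>)\<close>.\<close>
  define \<beta> where "\<beta> = c \<otimes> x \<oplus> d \<otimes> y"
  define \<gamma> where "\<gamma> = d \<otimes> a1 \<ominus> c \<otimes> b1"
  have bg: "\<beta> \<in> carrier R" "\<gamma> \<in> carrier R" using car e by (simp_all add: \<beta>_def \<gamma>_def)
  have "c = c \<otimes> (a1 \<otimes> x \<oplus> b1 \<otimes> y)" using e_eqs(3) car by simp
  also have "\<dots> = \<beta> \<otimes> a1 \<ominus> \<gamma> \<otimes> y"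
    unfolding \<beta>_def \<gamma>_def using car e by (simp add: cring_normalize)
  finally have c_eq: "c = \<beta> \<otimes> a1 \<ominus> \<gamma> \<otimes> y" .
  have "d = d \<otimes> (a1 \<otimes> x \<oplus> b1 \<otimes> y)" using e_eqs(3) car by simp
  also have "\<dots> = \<beta> \<otimes> b1 \<oplus> \<gamma> \<otimes> x"
    unfolding \<beta>_def \<gamma>_def using car e by (simp add: cring_normalize)
  finally have d_eq: "d = \<beta> \<otimes> b1 \<oplus> \<gamma> \<otimes> x" .
  obtain g \<alpha>' \<beta>' \<gamma>' u v w where g: "g \<in> carrier R" "\<alpha>' \<in> carrier R" "\<beta>' \<in> carrier R"
    "\<gamma>' \<in> carrier R" "u \<in> carrier R" "v \<in> carrier R" "w \<in> carrier R"
    and g_eqs: "\<alpha> = g \<otimes> \<alpha>'" "\<beta> = g \<otimes> \<beta>'" "\<gamma> = g \<otimes> \<gamma>'"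
    and uni: "\<alpha>' \<otimes> u \<oplus> \<beta>' \<otimes> v \<oplus> \<gamma>' \<otimes> w = \<one>"
    using hermite3[OF e(1) bg] by metis
  obtain p q r s where w: "p \<in> carrier R" "q \<in> carrier R" "r \<in> carrier R" "s \<in> carrier R"
    and one: "p \<otimes> (\<alpha>' \<otimes> r) \<oplus> q \<otimes> (\<beta>' \<otimes> r \<oplus> \<gamma>' \<otimes> s) = \<one>"
    using unimodular_triangular_represents_one[OF g(2-7) uni] by metis
  \<comment> \<open>The column operation applied to the vector \<open>(r, s)\<close>.\<close>
  define r' where "r' = x \<otimes> r \<ominus> b1 \<otimes> s"
  define s' where "s' = y \<otimes> r \<oplus> a1 \<otimes> s"
  have r's': "r' \<in> carrier R" "s' \<in> carrier R" using w e by (simp_all add: r'_def s'_def)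
  have r_eq: "a1 \<otimes> r' \<oplus> b1 \<otimes> s' = r"
  proof -
    have "a1 \<otimes> r' \<oplus> b1 \<otimes> s' = (a1 \<otimes> x \<oplus> b1 \<otimes> y) \<otimes> r"
      unfolding r'_def s'_def using e w by (simp add: cring_normalize)
    then show ?thesis using e_eqs(3) w by simp
  qed
  have s_eq: "x \<otimes> s' \<ominus> y \<otimes> r' = s"
  proof -
    have "x \<otimes> s' \<ominus> y \<otimes> r' = (a1 \<otimes> x \<oplus> b1 \<otimes> y) \<otimes> s"
      unfolding r'_def s'_def using e w by (simp add: cring_normalize)
    then show ?thesis using e_eqs(3) w by simp
  qed
  have ab: "a \<otimes> r' \<oplus> b \<otimes> s' = g \<otimes> (\<alpha>' \<otimes> r)"
  proof -
    have "a \<otimes> r' \<oplus> b \<otimes> s' = \<alpha> \<otimes> (a1 \<otimes> r' \<oplus> b1 \<otimes> s')"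
      unfolding e_eqs(1,2) using e r's' by (simp add: cring_normalize)
    then show ?thesis unfolding r_eq g_eqs(1) using g w by (simp add: m_assoc)
  qed
  have cd: "c \<otimes> r' \<oplus> d \<otimes> s' = g \<otimes> (\<beta>' \<otimes> r \<oplus> \<gamma>' \<otimes> s)"
  proof -
    have "c \<otimes> r' \<oplus> d \<otimes> s' = \<beta> \<otimes> (a1 \<otimes> r' \<oplus> b1 \<otimes> s') \<oplus> \<gamma> \<otimes> (x \<otimes> s' \<ominus> y \<otimes> r')"
      unfolding c_eq d_eq using e r's' bg by (simp add: cring_normalize)
    then show ?thesis unfolding r_eq s_eq g_eqs(2,3) using g w by (simp add: m_assoc r_distr)
  qed
  have "p \<otimes> (a \<otimes> r' \<oplus> b \<otimes> s') \<oplus> q \<otimes> (c \<otimes> r' \<oplus> d \<otimes> s')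
      = g \<otimes> (p \<otimes> (\<alpha>' \<otimes> r) \<oplus> q \<otimes> (\<beta>' \<otimes> r \<oplus> \<gamma>' \<otimes> s))"
    unfolding ab cd using g w by (simp add: cring_normalize)
  then have main: "p \<otimes> (a \<otimes> r' \<oplus> b \<otimes> s') \<oplus> q \<otimes> (c \<otimes> r' \<oplus> d \<otimes> s') = g"
    unfolding one using g by simp
  have "a = g \<otimes> (\<alpha>' \<otimes> a1)" "b = g \<otimes> (\<alpha>' \<otimes> b1)"
    "c = g \<otimes> (\<beta>' \<otimes> a1 \<ominus> \<gamma>' \<otimes> y)" "d = g \<otimes> (\<beta>' \<otimes> b1 \<oplus> \<gamma>' \<otimes> x)"
    unfolding e_eqs(1,2) c_eq d_eq g_eqs using g e by (simp_all add: cring_normalize)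
  then have dv: "g divides a" "g divides b" "g divides c" "g divides d"
    unfolding factor_def using g e by blast+
  have "(p \<otimes> \<alpha>' \<oplus> q \<otimes> \<beta>') \<otimes> r \<oplus> (q \<otimes> \<gamma>') \<otimes> s = p \<otimes> (\<alpha>' \<otimes> r) \<oplus> q \<otimes> (\<beta>' \<otimes> r \<oplus> \<gamma>' \<otimes> s)"
    using g w by (simp add: cring_normalize)
  then have rs1: "(p \<otimes> \<alpha>' \<oplus> q \<otimes> \<beta>') \<otimes> r \<oplus> (q \<otimes> \<gamma>') \<otimes> s = \<one>" using one by simp
  have "((p \<otimes> \<alpha>' \<oplus> q \<otimes> \<beta>') \<otimes> a1 \<ominus> q \<otimes> \<gamma>' \<otimes> y) \<otimes> r'
      \<oplus> ((p \<otimes> \<alpha>' \<oplus> q \<otimes> \<beta>') \<otimes> b1 \<oplus> q \<otimes> \<gamma>' \<otimes> x) \<otimes> s'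
    = (p \<otimes> \<alpha>' \<oplus> q \<otimes> \<beta>') \<otimes> (a1 \<otimes> r' \<oplus> b1 \<otimes> s') \<oplus> (q \<otimes> \<gamma>') \<otimes> (x \<otimes> s' \<ominus> y \<otimes> r')"
    using g w e r's' by (simp add: cring_normalize)
  also have "\<dots> = \<one>" unfolding r_eq s_eq by (rule rs1)
  finally have col: "\<exists>x\<in>carrier R. \<exists>y\<in>carrier R. x \<otimes> r' \<oplus> y \<otimes> s' = \<one>" using g w e by blast
  have row: "\<exists>x\<in>carrier R. \<exists>y\<in>carrier R. p \<otimes> x \<oplus> q \<otimes> y = \<one>"
    using one g w by blast
  show thesis using that[OF w(1,2) r's' g(1) main dv row col] .
qed

text \<open>
  A column \<open>d (a, b)\<close> with \<open>a x + b y = \<one>\<close> is mapped to \<open>(d, \<zero>)\<close> by the determinant 1 matrix with rows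
  \<open>(x, y)\<close> and \<open>(-b, a)\<close>.
\<close>

lemma gcd_pivot_2_1: "gcd_pivot 2 1"
  unfolding gcd_pivot_def
proof
  fix A assume A: "A \<in> mats R 2 1"
  obtain d a b x y where car: "d \<in> carrier R" "a \<in> carrier R" "b \<in> carrier R"
    "x \<in> carrier R" "y \<in> carrier R"
    and eqs: "A $$ (0, 0) = d \<otimes> a" "A $$ (1, 0) = d \<otimes> b" "a \<otimes> x \<oplus> b \<otimes> y = \<one>"
    by (rule hermite[of "A $$ (0, 0)" "A $$ (1, 0)"]) (use mats_entry[OF A] in simp_all)
  define P where "P = mat2 x y (\<ominus> b) a"
  have "x \<otimes> a \<ominus> y \<otimes> \<ominus> b = a \<otimes> x \<oplus> b \<otimes> y" using car by (simp add: cring_normalize)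
  then have P: "P \<in> GL 2" unfolding P_def using car eqs(3) by (intro mat2_GL) simp_all
  have "(P \<odot> A) $$ (0, 0) = x \<otimes> (d \<otimes> a) \<oplus> y \<otimes> (d \<otimes> b)"
    using A car eqs by (simp add: mat_times_index mats_iff P_def mat2_def finsum_lessThan_2)
  also have "\<dots> = d \<otimes> (a \<otimes> x \<oplus> b \<otimes> y)" using car by (simp add: cring_normalize)
  also have "\<dots> = d" using eqs(3) car by simp
  finally have "(P \<odot> A \<odot> mat_one R 1) $$ (0, 0) = d"
    using mat_times_one_right[OF mat_times_closed[OF GL_mats[OF P] A]] by simp
  moreover have "divides_mat d A"
    using mats_dim[OF A] eqs(1,2) car unfolding divides_mat_def factor_def
    by (auto simp: less_2_cases_iff)
  ultimately show "\<exists>P\<in>GL 2. \<exists>Q\<in>GL 1. divides_mat ((P \<odot> A \<odot> Q) $$ (0, 0)) A"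
    using P GL_one[of 1] by metis
qed

text \<open>
  The unimodular row and column that represent the content are completed to matrices of
  determinant 1; the product then has the content as its corner entry.
\<close>

lemma gcd_pivot_2_2: "gcd_pivot 2 2"
  unfolding gcd_pivot_def
proof
  fix A assume A: "A \<in> mats R 2 2"
  define a b c d where abcd: "a = A $$ (0, 0)" "b = A $$ (0, 1)" "c = A $$ (1, 0)" "d = A $$ (1, 1)"
  have car: "a \<in> carrier R" "b \<in> carrier R" "c \<in> carrier R" "d \<in> carrier R"
    using mats_entry[OF A] by (simp_all add: abcd)
  obtain p q r s g x y x' y' where w: "p \<in> carrier R" "q \<in> carrier R" "r \<in> carrier R" "s \<in> carrier R"
    and g: "g \<in> carrier R" and g_eq: "p \<otimes> (a \<otimes> r \<oplus> b \<otimes> s) \<oplus> q \<otimes> (c \<otimes> r \<oplus> d \<otimes> s) = g"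
    and dvd: "g divides a" "g divides b" "g divides c" "g divides d"
    and xy: "x \<in> carrier R" "y \<in> carrier R" "p \<otimes> x \<oplus> q \<otimes> y = \<one>"
    and xy': "x' \<in> carrier R" "y' \<in> carrier R" "x' \<otimes> r \<oplus> y' \<otimes> s = \<one>"
    using content_represented_2x2[OF car] by metis
  define P where "P = mat2 p q (\<ominus> y) x"
  define Q where "Q = mat2 r (\<ominus> y') s x'"
  have "p \<otimes> x \<ominus> q \<otimes> \<ominus> y = p \<otimes> x \<oplus> q \<otimes> y" using w xy by (simp add: cring_normalize)
  then have P: "P \<in> GL 2" unfolding P_def using w xy by (intro mat2_GL) simp_all
  have "r \<otimes> x' \<ominus> \<ominus> y' \<otimes> s = x' \<otimes> r \<oplus> y' \<otimes> s" using w xy' by (simp add: cring_normalize)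
  then have Q: "Q \<in> GL 2" unfolding Q_def using w xy' by (intro mat2_GL) simp_all
  have AQ: "A \<odot> Q \<in> mats R 2 2" by (rule mat_times_closed[OF A GL_mats[OF Q]])
  have "(A \<odot> Q) $$ (0, 0) = a \<otimes> r \<oplus> b \<otimes> s" "(A \<odot> Q) $$ (1, 0) = c \<otimes> r \<oplus> d \<otimes> s"
    using car w mats_dim[OF A]
    by (simp_all add: mat_times_index Q_def mat2_def finsum_lessThan_2 abcd)
  then have "(P \<odot> (A \<odot> Q)) $$ (0, 0) = g"
    using car w g_eq mats_dim[OF AQ]
    by (simp add: mat_times_index P_def mat2_def finsum_lessThan_2 del: mat_times_dim)
  then have "(P \<odot> A \<odot> Q) $$ (0, 0) = g"
    using mat_times_assoc[OF GL_mats[OF P] A GL_mats[OF Q]] by simp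
  moreover have "divides_mat g A"
    using mats_dim[OF A] dvd unfolding divides_mat_def abcd
    by (auto simp: less_2_cases_iff)
  ultimately show "\<exists>P\<in>GL 2. \<exists>Q\<in>GL 2. divides_mat ((P \<odot> A \<odot> Q) $$ (0, 0)) A"
    using P Q by metis
qed

lemma elementary_divisor_ring: "elementary_divisor_ring R"
  unfolding elementary_divisor_ring_def
  using diagonal_reduction_of_gcd_pivot gcd_pivot_all[OF gcd_pivot_2_1 gcd_pivot_2_2] by blast

end

theorem theorem4p3:
  fixes R :: "('a, 'b) ring_scheme"
  assumes "cring R"
    and "J_stable R"
  shows "bezout_ring R \<longleftrightarrow> elementary_divisor_ring R"
proof
  assume "bezout_ring R"
  then have "bezout_J_stable_ring R"
    using assms by (intro bezout_J_stable_ring.intro J_stable_ring.intro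
        J_stable_ring_axioms.intro bezout_J_stable_ring_axioms.intro)
  then show "elementary_divisor_ring R" by (rule bezout_J_stable_ring.elementary_divisor_ring)
next
  assume "elementary_divisor_ring R"
  then show "bezout_ring R" by (rule cring.elementary_divisor_ring_imp_bezout_ring[OF assms(1)])
qed

end
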